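(* Let $G$ be a locally compact second countable (lcsc) group. If $G$ is sofic, then $G$ is unimodular.
   Context: lcsc means locally compact, second countable (and Hausdorff). Let $G$ be an lcsc group. Local $G$-spaces. A partial right-action of $G$ on a Hausdorff space $M$ is a continuous map $\alpha:\mathrm{dom}(\alpha)\to M$, with $\mathrm{dom}(\alpha)\subset M\times G$ open, such that for all $p\in M$ and $g,h\in G$: (1) $(p,1_G)\in \mathrm{dom}(\alpha)$ and $\alpha(p,1_G)=p$; (2) if $(p,g)\in\mathrm{dom}(\alpha)$ then $(\alpha(p,g),g^{-1})\in\mathrm{dom}(\alpha)$ and $\alpha(\alpha(p,g),g^{-1})=p$; (3) if $(p,g),(\alpha(p,g),h),(p,gh)\in\mathrm{dom}(\alpha)$ then $\alpha(p,gh)=\alpha(\alpha(p,g),h)$. It is homogeneous if moreover (4) for every $p\in M$ there is an open neighborhood $O_p$ of $1_G$ in $G$ such that $\{p\}\times O_p\subset\mathrm{dom}(\alpha)$ and $g\mapsto\alpha(p,g)$ restricted to $O_p$ is a homeomorphism onto an open neighborhood of $p$ in $M$. A local $G$-space is a pair $(M,\alpha)$ with $M$ an lcsc space and $\alpha$ a partial homogeneous right-action of $G$ on $M$. Write $p.g=\alpha(p,g)$ (well-defined when $(p,g)\in\mathrm{dom}(\alpha)$) and $p.g.h=(p.g).h$. Charts and the canonical measure. A chart centered at $p\in M$ is a homeomorphism $f_p:\mathrm{dom}(f_p)\to\mathrm{rng}(f_p)$ from an open neighborhood of $p$ in $M$ onto an open neighborhood of $1_G$ in $G$ with $f_p(p.g)=g$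 for all $g\in\mathrm{rng}(f_p)$. Fix a left-Haar measure $\mathrm{Haar}_G$ on $G$. $\mathrm{vol}_M$ denotes the unique Radon measure on $M$ such that $\mathrm{vol}_M(K)=\mathrm{Haar}_G(f_p(K))$ whenever $f_p$ is a chart and $K\subset\mathrm{dom}(f_p)$ is Borel. Soficity. For $U\subset G$ open and pre-compact, $M[U]$ is the set of all $p\in M$ such that (i) whenever $g,h\in G$ satisfy $g,h,gh\in U$, then $p.g.h=p.gh$ (in particular both sides are well-defined), and (ii) $g\mapsto p.g$ is a homeomorphism from $U$ to an open neighborhood of $p$. For $\epsilon>0$, $M$ is a $(U,\epsilon)$-sofic approximation to $G$ if $\mathrm{vol}_M(M)<\infty$ and $\mathrm{vol}_M(M[U])\ge(1-\epsilon)\mathrm{vol}_M(M)$. A sofic approximation to $G$ is a sequence $(M_i)_{i=1}^\infty$ where $M_i$ is a $(U_i,\epsilon_i)$-sofic approximation, the $U_i$ are pre-compact open sets increasing to $G$, $\epsilon_i$ decreases to $0$, and $M_i$ is nonempty for all but finitely many $i$. $G$ is sofic if it admits a sofic approximation. $G$ is unimodular if its left-Haar measure is also right-invariant. *)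

theory Defs
  imports "HOL-Analysis.Analysis"
begin

(* The group G is a type of class topological_group_add. That class is built on group_add, which is
   not commutative; the group law gh is written g + h, the unit 1 is 0 and the inverse is - g.
   G-spaces are explicit topologies ('m topology), since they vary along a sequence and may be
   empty. *)

definition lcsc_space :: "'a topology \<Rightarrow> bool" where
  "lcsc_space X \<longleftrightarrow> locally_compact_space X \<and> second_countable X \<and> Hausdorff_space X"


subsection \<open>Radon and Haar measures\<close>

definition borel_algebra :: "'a topology \<Rightarrow> 'a set set" where
  "borel_algebra X = sigma_sets (topspace X) {U. openin X U}"

definition radon_measure :: "'a topology \<Rightarrow> 'a measure \<Rightarrow> bool" where
  "radon_measure X \<mu> \<longleftrightarrow>
     space \<mu> = topspace X \<and> sets \<mu> = borel_algebra X \<and>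
     (\<forall>K. compactin X K \<longrightarrow> emeasure \<mu> K < \<infinity>) \<and>
     (\<forall>A \<in> sets \<mu>. emeasure \<mu> A = (INF U \<in> {U. openin X U \<and> A \<subseteq> U}. emeasure \<mu> U)) \<and>
     (\<forall>U. openin X U \<longrightarrow> emeasure \<mu> U = (SUP K \<in> {K. compactin X K \<and> K \<subseteq> U}. emeasure \<mu> K))"

definition left_haar_measure :: "'g::topological_group_add measure \<Rightarrow> bool" where
  "left_haar_measure \<mu> \<longleftrightarrow>
     radon_measure euclidean \<mu> \<and> emeasure \<mu> UNIV \<noteq> 0 \<and>
     (\<forall>g. \<forall>A \<in> sets \<mu>. emeasure \<mu> ((\<lambda>x. g + x) ` A) = emeasure \<mu> A)"

(* The argument is the fixed left Haar measure of G. *)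
definition unimodular :: "'g::topological_group_add measure \<Rightarrow> bool" where
  "unimodular haar \<longleftrightarrow>
     (\<forall>g. \<forall>A \<in> sets haar. emeasure haar ((\<lambda>x. x + g) ` A) = emeasure haar A)"


subsection \<open>Local G-spaces\<close>

(* A partial action is a partial function \<alpha>, so that dom \<alpha> is its domain; act \<alpha> p g is p.g, and
   is meaningful only for (p, g) \<in> dom \<alpha>. *)
definition act :: "('m \<times> 'g \<rightharpoonup> 'm) \<Rightarrow> 'm \<Rightarrow> 'g \<Rightarrow> 'm" where
  "act \<alpha> p g = the (\<alpha> (p, g))"

definition partial_right_action ::
    "'m topology \<Rightarrow> ('m \<times> 'g::topological_group_add \<rightharpoonup> 'm) \<Rightarrow> bool" where
  "partial_right_action M \<alpha> \<longleftrightarrow>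
     openin (prod_topology M euclidean) (dom \<alpha>) \<and>
     continuous_map (subtopology (prod_topology M euclidean) (dom \<alpha>)) M (\<lambda>(p, g). act \<alpha> p g) \<and>
     (\<forall>p \<in> topspace M. (p, 0) \<in> dom \<alpha> \<and> act \<alpha> p 0 = p) \<and>
     (\<forall>p \<in> topspace M. \<forall>g. (p, g) \<in> dom \<alpha> \<longrightarrow>
        (act \<alpha> p g, - g) \<in> dom \<alpha> \<and> act \<alpha> (act \<alpha> p g) (- g) = p) \<and>
     (\<forall>p \<in> topspace M. \<forall>g h.
        (p, g) \<in> dom \<alpha> \<and> (act \<alpha> p g, h) \<in> dom \<alpha> \<and> (p, g + h) \<in> dom \<alpha> \<longrightarrow>
        act \<alpha> p (g + h) = act \<alpha> (act \<alpha> p g) h)"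

definition orbit_map_homeo ::
    "'m topology \<Rightarrow> ('m \<times> 'g::topological_group_add \<rightharpoonup> 'm) \<Rightarrow> 'm \<Rightarrow> 'g set \<Rightarrow> bool" where
  "orbit_map_homeo M \<alpha> p U \<longleftrightarrow>
     {p} \<times> U \<subseteq> dom \<alpha> \<and>
     (\<exists>V. openin M V \<and> p \<in> V \<and> homeomorphic_map (top_of_set U) (subtopology M V) (act \<alpha> p))"

definition homogeneous ::
    "'m topology \<Rightarrow> ('m \<times> 'g::topological_group_add \<rightharpoonup> 'm) \<Rightarrow> bool" where
  "homogeneous M \<alpha> \<longleftrightarrow> (\<forall>p \<in> topspace M. \<exists>N. open N \<and> 0 \<in> N \<and> orbit_map_homeo M \<alpha> p N)"

definition local_G_space ::
    "'m topology \<Rightarrow> ('m \<times> 'g::topological_group_add \<rightharpoonup> 'm) \<Rightarrow> bool" where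
  "local_G_space M \<alpha> \<longleftrightarrow> lcsc_space M \<and> partial_right_action M \<alpha> \<and> homogeneous M \<alpha>"


subsection \<open>Charts and the canonical measure\<close>

(* f, restricted to V, is a chart centered at p with domain V and range W. *)
definition chart ::
    "'m topology \<Rightarrow> ('m \<times> 'g::topological_group_add \<rightharpoonup> 'm) \<Rightarrow> 'm \<Rightarrow> 'm set \<Rightarrow> 'g set \<Rightarrow> ('m \<Rightarrow> 'g) \<Rightarrow> bool"
  where
  "chart M \<alpha> p V W f \<longleftrightarrow>
     openin M V \<and> p \<in> V \<and> open W \<and> 0 \<in> W \<and>
     homeomorphic_map (subtopology M V) (top_of_set W) f \<and>
     (\<forall>g \<in> W. (p, g) \<in> dom \<alpha> \<and> act \<alpha> p g \<in> V \<and> f (act \<alpha> p g) = g)"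

definition vol ::
    "'g::topological_group_add measure \<Rightarrow> 'm topology \<Rightarrow> ('m \<times> 'g \<rightharpoonup> 'm) \<Rightarrow> 'm measure" where
  "vol haar M \<alpha> = (THE \<nu>. radon_measure M \<nu> \<and>
     (\<forall>p V W f K. chart M \<alpha> p V W f \<and> K \<in> borel_algebra M \<and> K \<subseteq> V \<longrightarrow>
        emeasure \<nu> K = emeasure haar (f ` K)))"


subsection \<open>Soficity\<close>

(* This is M[U]. It is a Borel set when U is open and M is a local G-space: U is sigma-compact, and
   injective orbit maps are open by homogeneity. Hence its emeasure below is not the default 0 of
   non-measurable sets. *)
definition good_points ::
    "'m topology \<Rightarrow> ('m \<times> 'g::topological_group_add \<rightharpoonup> 'm) \<Rightarrow> 'g set \<Rightarrow> 'm set" where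
  "good_points M \<alpha> U = {p \<in> topspace M.
     (\<forall>g h. g \<in> U \<and> h \<in> U \<and> g + h \<in> U \<longrightarrow>
        (p, g) \<in> dom \<alpha> \<and> (act \<alpha> p g, h) \<in> dom \<alpha> \<and> (p, g + h) \<in> dom \<alpha> \<and>
        act \<alpha> (act \<alpha> p g) h = act \<alpha> p (g + h)) \<and>
     orbit_map_homeo M \<alpha> p U}"

definition sofic_approx ::
    "'g::topological_group_add measure \<Rightarrow> 'g set \<Rightarrow> real \<Rightarrow> 'm topology \<Rightarrow> ('m \<times> 'g \<rightharpoonup> 'm) \<Rightarrow> bool"
  where
  "sofic_approx haar U \<epsilon> M \<alpha> \<longleftrightarrow>
     open U \<and> compact (closure U) \<and> 0 < \<epsilon> \<and> local_G_space M \<alpha> \<and>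
     emeasure (vol haar M \<alpha>) (topspace M) < \<infinity> \<and>
     emeasure (vol haar M \<alpha>) (good_points M \<alpha> U)
       \<ge> ennreal (1 - \<epsilon>) * emeasure (vol haar M \<alpha>) (topspace M)"

(* The type 'm only bounds the size of the spaces M i. An lcsc space has at most continuum many
   points, so for instance sofic TYPE(real) imposes no restriction. *)
definition sofic :: "'m itself \<Rightarrow> 'g::topological_group_add measure \<Rightarrow> bool" where
  "sofic (_ :: 'm itself) haar \<longleftrightarrow>
     (\<exists>(M :: nat \<Rightarrow> 'm topology) \<alpha> U \<epsilon>.
        (\<forall>i. sofic_approx haar (U i) (\<epsilon> i) (M i) (\<alpha> i)) \<and>
        incseq U \<and> (\<Union>i. U i) = UNIV \<and>
        decseq \<epsilon> \<and> \<epsilon> \<longlonglongrightarrow> 0 \<and>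
        (\<forall>\<^sub>F i in sequentially. topspace (M i) \<noteq> {}))"

end

theory Submission
  imports Defs
begin

text \<open>Right translation by \<open>g\<close> multiplies the left Haar measure by a constant \<open>D\<close>, by uniqueness of
  Haar measure. On a local G-space the partial map \<open>p \<mapsto> p.g\<close> is injective, and in charts it
  reads \<open>x \<mapsto> - g + x + g\<close>, so it multiplies the canonical volume by \<open>D\<close>. It is defined on
  \<open>M[U]\<close> as soon as \<open>g \<in> U\<close>; if \<open>M\<close> is a \<open>(U, \<epsilon>)\<close>-sofic approximation, comparing the
  volume of the image of \<open>M[U]\<close> with the finite volume of \<open>M\<close> gives \<open>D (1 - \<epsilon>) \<le> 1\<close>.
  Hence \<open>D \<le> 1\<close> for every \<open>g\<close>, and applying this to \<open>- g\<close> gives \<open>D = 1\<close>.\<close>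

text \<open>\<open>vol\<close> is a definite description, so nothing can be computed with it until a
  canonical measure is shown to exist and to be unique; much of the work goes there. The obstacle
  throughout is that chart transitions and the map \<open>p \<mapsto> p.g\<close> have a simple form
  only near each point, and the translating element may vary with the point. Equalities of measures
  are therefore proved on small neighbourhoods and spread by one local-to-global principle for
  countably additive set functions. It applies to the volume of translates because the factor D is
  the same at every point. The conjugation comes from the change of centre: x.g = p.(f x + g) has
  coordinate - g + f x + g in a chart centred at p.g. Left invariance absorbs the left factor, so
  only the right translation is felt. Cancelling the volume of M requires it to be positive as well
  as finite, which is where nonemptiness of the spaces enters.\<close>

section \<open>Borel sets of a topology\<close>

lemma sigma_algebra_borel_algebra: "sigma_algebra (topspace X) (borel_algebra X)"
  unfolding borel_algebra_def
  by (rule sigma_algebra_sigma_sets) (auto dest: openin_subset)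

lemma borel_algebra_subset: "A \<in> borel_algebra X \<Longrightarrow> A \<subseteq> topspace X"
  unfolding borel_algebra_def by (erule sigma_sets_into_sp[rotated]) (auto dest: openin_subset)

lemma borel_algebra_openin: "openin X U \<Longrightarrow> U \<in> borel_algebra X"
  by (simp add: borel_algebra_def sigma_sets.Basic)

lemma borel_algebra_euclidean: "borel_algebra euclidean = sets borel"
  by (simp add: borel_algebra_def borel_def)

lemma borel_algebra_Int: "A \<in> borel_algebra X \<Longrightarrow> B \<in> borel_algebra X \<Longrightarrow> A \<inter> B \<in> borel_algebra X"
proof -
  interpret sigma_algebra "topspace X" "borel_algebra X"
    by (rule sigma_algebra_borel_algebra)
  show "A \<in> borel_algebra X \<Longrightarrow> B \<in> borel_algebra X \<Longrightarrow> A \<inter> B \<in> borel_algebra X"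
    by (rule Int)
qed

lemma borel_algebra_disjointed:
  assumes "\<And>n::nat. openin X (V n)"
  shows "disjointed V n \<in> borel_algebra X"
proof -
  interpret sigma_algebra "topspace X" "borel_algebra X"
    by (rule sigma_algebra_borel_algebra)
  show ?thesis
    using range_disjointed_sets[of V] assms borel_algebra_openin by blast
qed

text \<open>Sets whose trace on S has Borel image are closed under the sigma-algebra operations:
  openness of \<phi> handles open sets, and injectivity makes the image commute with complements
  relative to S. The intended maps are charts and partial translations.\<close>

lemma borel_algebra_image:
  assumes S: "openin X S" and inj: "inj_on \<phi> S"
    and op: "\<And>U. openin X U \<Longrightarrow> U \<subseteq> S \<Longrightarrow> openin Y (\<phi> ` U)"
    and K: "K \<in> borel_algebra X" "K \<subseteq> S"
  shows "\<phi> ` K \<in> borel_algebra Y"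
proof -
  interpret Y: sigma_algebra "topspace Y" "borel_algebra Y"
    by (rule sigma_algebra_borel_algebra)
  have SX: "S \<subseteq> topspace X"
    using S by (rule openin_subset)
  have "\<phi> ` (K \<inter> S) \<in> borel_algebra Y"
    using K(1) unfolding borel_algebra_def[of X]
  proof (induction K rule: sigma_sets.induct)
    case (Basic U)
    then show ?case
      using S by (intro borel_algebra_openin op) auto
  next
    case Empty
    show ?case by simp
  next
    case (Compl A)
    have "\<phi> ` ((topspace X - A) \<inter> S) = \<phi> ` S - \<phi> ` (A \<inter> S)"
      using SX inj by (auto simp: inj_on_def)
    moreover have "\<phi> ` S \<in> borel_algebra Y"
      using S by (intro borel_algebra_openin op) auto
    ultimately show ?case
      using Compl by auto
  next
    case (Union A)
    then have "(\<Union>i. \<phi> ` (A i \<inter> S)) \<in> borel_algebra Y"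
      by blast
    moreover have "\<phi> ` (\<Union> (range A) \<inter> S) = (\<Union>i. \<phi> ` (A i \<inter> S))"
      by blast
    ultimately show ?case by simp
  qed
  then show ?thesis
    using K(2) by (simp add: Int_absorb2)
qed

section \<open>Countably additive set functions and passage from local to global\<close>

lemma countably_additive_image:
  assumes "inj_on \<phi> S" and "\<And>K. K \<in> \<B> \<Longrightarrow> K \<subseteq> S \<and> \<phi> ` K \<in> sets \<mu>"
  shows "countably_additive \<B> (\<lambda>K. emeasure \<mu> (\<phi> ` K))"
proof (rule countably_additiveI)
  fix A :: "nat \<Rightarrow> 'a set"
  assume A: "range A \<subseteq> \<B>" "disjoint_family A" "\<Union> (range A) \<in> \<B>"
  then have *: "A i \<subseteq> S" "\<phi> ` A i \<in> sets \<mu>" for i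
    using assms(2) by blast+
  have "disjoint_family (\<lambda>i. \<phi> ` A i)"
    using A(2) * assms(1) unfolding disjoint_family_on_def inj_on_def by blast
  then show "(\<Sum>i. emeasure \<mu> (\<phi> ` A i)) = emeasure \<mu> (\<phi> ` \<Union> (range A))"
    using * by (simp add: suminf_emeasure image_UN image_subset_iff)
qed

lemma countably_additive_restrict:
  assumes "countably_additive \<B> m" "\<C> \<subseteq> \<B>"
  shows "countably_additive \<C> m"
  using assms unfolding countably_additive_def by blast

lemma suminf_swap_ennreal: "(\<Sum>i::nat. \<Sum>n::nat. a i n :: ennreal) = (\<Sum>n. \<Sum>i. a i n)"
proof -
  have "(\<Sum>i. \<Sum>n. a i n) = (\<integral>\<^sup>+ i. (\<Sum>n. a i n) \<partial>count_space UNIV)"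
    by (simp add: nn_integral_count_space_nat)
  also have "\<dots> = (\<Sum>n. \<integral>\<^sup>+ i. a i n \<partial>count_space UNIV)"
    by (rule nn_integral_suminf) simp
  finally show ?thesis
    by (simp add: nn_integral_count_space_nat)
qed

text \<open>A Lindelof argument that keeps the property Q: the basis sets contained in some good V
  already cover S, and one good V is chosen for each of them.\<close>

lemma second_countable_cover:
  assumes X: "second_countable X" and "S \<noteq> {}"
    and cov: "\<And>p. p \<in> S \<Longrightarrow> \<exists>V. openin X V \<and> p \<in> V \<and> Q V"
  obtains V :: "nat \<Rightarrow> 'a set"
    where "\<And>n. openin X (V n)" "\<And>n. Q (V n)" "S \<subseteq> (\<Union>n. V n)"
proof -
  obtain \<B> where \<B>: "countable \<B>"
      "\<And>U x. openin X U \<Longrightarrow> x \<in> U \<Longrightarrow> \<exists>B\<in>\<B>. x \<in> B \<and> B \<subseteq> U"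
    using X unfolding second_countable_def by metis
  define \<C> where "\<C> = {B \<in> \<B>. \<exists>V. openin X V \<and> Q V \<and> B \<subseteq> V}"
  have S: "\<exists>B\<in>\<C>. p \<in> B" if "p \<in> S" for p
    using cov[OF that] \<B>(2) unfolding \<C>_def by blast
  have "\<forall>B\<in>\<C>. \<exists>V. openin X V \<and> Q V \<and> B \<subseteq> V"
    by (simp add: \<C>_def)
  then obtain W where W: "\<forall>B\<in>\<C>. openin X (W B) \<and> Q (W B) \<and> B \<subseteq> W B"
    by (rule bchoice[THEN exE])
  have c: "countable \<C>" "\<C> \<noteq> {}"
    using \<B>(1) S \<open>S \<noteq> {}\<close> by (auto simp: \<C>_def)
  \<comment> \<open>Nonemptiness of \<C>, inherited from S, allows a countable and possibly finite
    family to be enumerated by all natural numbers.\<close>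
  have rg: "range (from_nat_into \<C>) = \<C>"
    using c by (rule range_from_nat_into[rotated])
  define V where "V n = W (from_nat_into \<C> n)" for n
  show thesis
  proof (rule that[of V])
    show "openin X (V n)" "Q (V n)" for n
      using W rg by (auto simp: V_def)
    show "S \<subseteq> (\<Union>n. V n)"
    proof
      fix p assume "p \<in> S"
      then obtain B where "B \<in> \<C>" "p \<in> B" using S by blast
      moreover from this obtain n where "B = from_nat_into \<C> n" using rg by (metis rangeE)
      ultimately show "p \<in> (\<Union>n. V n)" using W by (auto simp: V_def)
    qed
  qed
qed

text \<open>Disjointing a countable cover by good neighbourhoods cuts A into pieces on which m1 and
  m2 agree, and countable additivity sums them. They are set functions on the Borel subsets of S
  rather than measures, since the Haar measure of a chart image is meaningful only inside the chart
  domain. Their value at \<open>{}\<close> settles the case of empty S.\<close>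

lemma countably_additive_eq_if_locally_eq:
  assumes X: "second_countable X" and S: "openin X S"
    and m1: "countably_additive {K \<in> borel_algebra X. K \<subseteq> S} m1"
    and m2: "countably_additive {K \<in> borel_algebra X. K \<subseteq> S} m2"
    and "m1 {} = m2 {}"
    and loc: "\<And>p. p \<in> S \<Longrightarrow> \<exists>V. openin X V \<and> p \<in> V \<and>
      (\<forall>K \<in> borel_algebra X. K \<subseteq> V \<longrightarrow> m1 K = m2 K)"
    and A: "A \<in> borel_algebra X" "A \<subseteq> S"
  shows "m1 A = m2 A"
proof (cases "S = {}")
  case True
  then show ?thesis using assms by simp
next
  case False
  interpret sigma_algebra "topspace X" "borel_algebra X"
    by (rule sigma_algebra_borel_algebra)
  obtain V :: "nat \<Rightarrow> 'a set" where V: "\<And>n. openin X (V n)"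
      "\<And>n. \<forall>K \<in> borel_algebra X. K \<subseteq> V n \<longrightarrow> m1 K = m2 K" "S \<subseteq> (\<Union>n. V n)"
    by (rule second_countable_cover[OF X False loc]) blast+
  define D where "D n = A \<inter> disjointed V n" for n
  have D: "D n \<in> borel_algebra X" "D n \<subseteq> S" "D n \<subseteq> V n" for n
    using A borel_algebra_disjointed[of X V] V(1) disjointed_subset[of V n]
    by (auto simp: D_def borel_algebra_Int)
  have A_eq: "(\<Union>n. D n) = A"
    using A V(3) UN_disjointed_eq[of V] by (auto simp: D_def)
  have dj: "disjoint_family D"
    using disjoint_family_disjointed[of V] unfolding D_def disjoint_family_on_def by blast
  have rg: "range D \<subseteq> {K \<in> borel_algebra X. K \<subseteq> S}"
    using D by auto
  have eq: "m1 (D n) = m2 (D n)" for n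
    using V(2)[of n] D[of n] by blast
  have "m1 A = (\<Sum>n. m1 (D n))"
    using m1[unfolded countably_additive_def, rule_format, OF rg dj] A A_eq by auto
  also have "\<dots> = (\<Sum>n. m2 (D n))"
    by (simp add: eq)
  also have "\<dots> = m2 A"
    using m2[unfolded countably_additive_def, rule_format, OF rg dj] A A_eq by auto
  finally show ?thesis .
qed

section \<open>Uniqueness of Haar measure\<close>

text \<open>Leaves out regularity and nontriviality, so that a right translate of
  \<open>haar\<close> qualifies without a regularity check.\<close>

definition left_invariant :: "'g::topological_group_add measure \<Rightarrow> bool" where
  "left_invariant \<mu> \<longleftrightarrow>
     sets \<mu> = sets borel \<and> (\<forall>g. \<forall>A \<in> sets borel. emeasure \<mu> ((\<lambda>x. g + x) ` A) = emeasure \<mu> A)"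

lemma left_invariant_sets: "left_invariant \<mu> \<Longrightarrow> sets \<mu> = sets borel"
  by (simp add: left_invariant_def)

lemma left_invariant_space: "left_invariant \<mu> \<Longrightarrow> space \<mu> = UNIV"
  using sets_eq_imp_space_eq[of \<mu> borel] by (simp add: left_invariant_def)

lemma left_invariant_emeasure:
  "left_invariant \<mu> \<Longrightarrow> A \<in> sets borel \<Longrightarrow> emeasure \<mu> ((\<lambda>x. g + x) ` A) = emeasure \<mu> A"
  by (simp add: left_invariant_def)

section \<open>Translations of sets and invariant integrals\<close>

lemma image_left_translation:
  fixes g :: "'g::group_add"
  shows "(\<lambda>x. g + x) ` A = (\<lambda>x. - g + x) -` A"
proof (intro equalityI subsetI)
  fix y assume "y \<in> (\<lambda>x. - g + x) -` A"
  then show "y \<in> (\<lambda>x. g + x) ` A"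
    by (intro image_eqI[of _ _ "- g + y"]) (auto simp: add.assoc[symmetric])
qed (auto simp: add.assoc[symmetric])

lemma image_right_translation:
  fixes g :: "'g::group_add"
  shows "(\<lambda>x. x + g) ` A = (\<lambda>x. x - g) -` A"
proof (intro equalityI subsetI)
  fix y assume "y \<in> (\<lambda>x. x - g) -` A"
  then show "y \<in> (\<lambda>x. x + g) ` A"
    by (intro image_eqI[of _ _ "y - g"]) auto
qed auto

lemma open_left_translation:
  fixes g :: "'g::topological_group_add"
  assumes "open A" shows "open ((\<lambda>x. g + x) ` A)"
  unfolding image_left_translation
  by (rule open_vimage) (auto intro!: continuous_intros assms)

lemma open_right_translation:
  fixes g :: "'g::topological_group_add"
  assumes "open A" shows "open ((\<lambda>x. x + g) ` A)"
  unfolding image_right_translation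
  by (rule open_vimage) (auto intro!: continuous_intros assms)

lemma borel_left_translation:
  fixes g :: "'g::{topological_group_add, second_countable_topology}"
  assumes "A \<in> sets borel" shows "(\<lambda>x. g + x) ` A \<in> sets borel"
  unfolding image_left_translation
  by (rule measurable_sets_borel[OF _ assms]) measurable

lemma measurable_right_translation:
  fixes g :: "'g::topological_group_add"
  shows "(\<lambda>x. x - g) \<in> borel_measurable borel"
  by (intro borel_measurable_continuous_onI continuous_intros)

lemma borel_right_translation:
  fixes g :: "'g::topological_group_add"
  assumes "A \<in> sets borel" shows "(\<lambda>x. x + g) ` A \<in> sets borel"
  unfolding image_right_translation
  by (rule measurable_sets_borel[OF measurable_right_translation assms])

text \<open>Every y is (y - b) + b for a fixed b in B, so the translates cover; Lindelof extracts
  countably many.\<close>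

lemma countable_translates_cover:
  fixes B :: "'g::{topological_group_add, second_countable_topology} set"
  assumes "open B" "B \<noteq> {}"
  obtains T where "countable T" "(\<Union>t\<in>T. (\<lambda>x. t + x) ` B) = UNIV"
proof -
  obtain b where b: "b \<in> B" using assms by auto
  have "(\<Union>t. (\<lambda>x. t + x) ` B) = UNIV"
  proof (intro set_eqI iffI)
    fix y :: 'g
    show "y \<in> (\<Union>t. (\<lambda>x. t + x) ` B)"
      using b by (intro UN_I[of "y - b"] image_eqI[of _ _ b]) auto
  qed simp
  moreover obtain \<F> where \<F>: "\<F> \<subseteq> range (\<lambda>t. (\<lambda>x. t + x) ` B)" "countable \<F>"
      "\<Union>\<F> = (\<Union>t. (\<lambda>x. t + x) ` B)"
    by (rule Lindelof[of "range (\<lambda>t. (\<lambda>x. t + x) ` B)"])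
      (use open_left_translation[OF assms(1)] in auto)
  moreover obtain T where "countable T" "\<F> = (\<lambda>t. (\<lambda>x. t + x) ` B) ` T"
    using \<F>(1,2) countable_subset_image[of \<F> "\<lambda>t. (\<lambda>x. t + x) ` B" UNIV] by auto
  ultimately show thesis
    using that[of T] by simp
qed

text \<open>If B were null, the group would be a countable union of null translates.\<close>

lemma left_invariant_open_pos:
  fixes \<mu> :: "'g::{topological_group_add, second_countable_topology} measure"
  assumes \<mu>: "left_invariant \<mu>" "emeasure \<mu> UNIV \<noteq> 0" and B: "open B" "B \<noteq> {}"
  shows "emeasure \<mu> B \<noteq> 0"
proof
  assume 0: "emeasure \<mu> B = 0"
  obtain T where T: "countable T" "(\<Union>t\<in>T. (\<lambda>x. t + x) ` B) = UNIV"
    using countable_translates_cover[OF B] .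
  have "(\<lambda>x. t + x) ` B \<in> null_sets \<mu>" for t
    using 0 borel_left_translation[of B t] left_invariant_emeasure[OF \<mu>(1), of B t] B(1)
    by (simp add: null_sets_def left_invariant_sets[OF \<mu>(1)])
  then have "(\<Union>t\<in>T. (\<lambda>x. t + x) ` B) \<in> null_sets \<mu>"
    using T(1) by (intro null_sets_UN')
  then show False
    using \<mu>(2) unfolding T(2) by (simp add: null_sets_def)
qed

lemma left_invariant_sigma_finite:
  fixes \<mu> :: "'g::{topological_group_add, second_countable_topology} measure"
  assumes \<mu>: "left_invariant \<mu>" and B: "open B" "B \<noteq> {}" "emeasure \<mu> B < \<infinity>"
  shows "sigma_finite_measure \<mu>"
proof
  obtain T where T: "countable T" "(\<Union>t\<in>T. (\<lambda>x. t + x) ` B) = UNIV"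
    using countable_translates_cover[OF B(1,2)] .
  have "emeasure \<mu> ((\<lambda>x. t + x) ` B) \<noteq> \<infinity>" for t
    using B(1,3) left_invariant_emeasure[OF \<mu>, of B t] by simp
  moreover have "(\<lambda>x. t + x) ` B \<in> sets \<mu>" for t
    using B(1) borel_left_translation[of B t] by (simp add: left_invariant_sets[OF \<mu>])
  ultimately show "\<exists>A. countable A \<and> A \<subseteq> sets \<mu> \<and> \<Union>A = space \<mu> \<and> (\<forall>a\<in>A. emeasure \<mu> a \<noteq> \<infinity>)"
    using T left_invariant_space[OF \<mu>]
    by (intro exI[of _ "(\<lambda>t. (\<lambda>x. t + x) ` B) ` T"]) (simp add: image_subset_iff)
qed

lemma nn_integral_left_invariant:
  fixes \<mu> :: "'g::{topological_group_add, second_countable_topology} measure"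
  assumes \<mu>: "left_invariant \<mu>" and f: "f \<in> borel_measurable borel"
  shows "(\<integral>\<^sup>+ x. f (a + x) \<partial>\<mu>) = (\<integral>\<^sup>+ x. f x \<partial>\<mu>)"
proof -
  note sets[measurable_cong] = left_invariant_sets[OF \<mu>] and sp = left_invariant_space[OF \<mu>]
  have "distr \<mu> borel (\<lambda>x. a + x) = \<mu>"
  proof (rule measure_eqI)
    fix A assume "A \<in> sets (distr \<mu> borel (\<lambda>x. a + x))"
    then have A: "A \<in> sets borel" by simp
    then have "emeasure (distr \<mu> borel (\<lambda>x. a + x)) A = emeasure \<mu> ((\<lambda>x. - a + x) ` A)"
      by (simp add: emeasure_distr sp image_left_translation)
    also have "\<dots> = emeasure \<mu> A"
      using \<mu> A by (rule left_invariant_emeasure)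
    finally show "emeasure (distr \<mu> borel (\<lambda>x. a + x)) A = emeasure \<mu> A" .
  qed (simp add: sets)
  then have "(\<integral>\<^sup>+ x. f x \<partial>\<mu>) = (\<integral>\<^sup>+ x. f x \<partial>distr \<mu> borel (\<lambda>x. a + x))"
    by simp
  also have "\<dots> = (\<integral>\<^sup>+ x. f (a + x) \<partial>\<mu>)"
    using f by (intro nn_integral_distr) measurable
  finally show ?thesis ..
qed

text \<open>Tonelli's theorem for the weight \<open>1\<^sub>A(x) 1\<^sub>B(y + x) / \<nu>(B - x)\<close>, whose integral over
  \<open>y\<close> is \<open>1\<^sub>A(x)\<close>: substituting \<open>x \<mapsto> - y + x\<close> and then \<open>y \<mapsto> x + y\<close> turns it into
  \<open>1\<^sub>A(- y) 1\<^sub>B(x) / \<nu>(B + y)\<close>, in which the variables are separated.\<close>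

lemma left_invariant_factor:
  fixes \<mu> \<nu> :: "'g::{topological_group_add, second_countable_topology} measure"
  assumes \<mu>: "left_invariant \<mu>" "sigma_finite_measure \<mu>"
    and \<nu>: "left_invariant \<nu>" "sigma_finite_measure \<nu>"
    and B[measurable]: "B \<in> sets borel"
    and pos: "\<And>g. emeasure \<nu> ((\<lambda>x. x + g) ` B) \<noteq> 0"
    and fin: "\<And>g. emeasure \<nu> ((\<lambda>x. x + g) ` B) < \<infinity>"
    and A[measurable]: "A \<in> sets borel"
  defines "w \<equiv> \<lambda>x. \<integral>\<^sup>+ t. indicator B (t + x) \<partial>\<nu>"
  shows "emeasure \<mu> A = (\<integral>\<^sup>+ y. indicator A (- y) / w (- y) \<partial>\<nu>) * emeasure \<mu> B"
proof -
  note s\<mu>[measurable_cong] = left_invariant_sets[OF \<mu>(1)]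
  note s\<nu>[measurable_cong] = left_invariant_sets[OF \<nu>(1)]
  interpret \<mu>: sigma_finite_measure \<mu> by fact
  interpret \<nu>: sigma_finite_measure \<nu> by fact
  interpret pair_sigma_finite \<mu> \<nu> ..
  have um[measurable]: "uminus \<in> borel_measurable (borel :: 'g measure)"
    by (intro borel_measurable_continuous_onI continuous_intros)
  have w[measurable]: "w \<in> borel_measurable borel"
    unfolding w_def by measurable
  have w_eq: "w x = emeasure \<nu> ((\<lambda>y. y + (- x)) ` B)" for x
  proof -
    have "w x = (\<integral>\<^sup>+ t. indicator ((\<lambda>y. y + (- x)) ` B) t \<partial>\<nu>)"
      unfolding w_def image_right_translation by (simp add: indicator_def)
    then show ?thesis
      using borel_right_translation[OF B, of "- x"] s\<nu> by simp
  qed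
  \<comment> \<open>In \<open>ennreal\<close> the quotient of w x by itself is 1 only when w x is
    neither 0 nor infinite; hence the hypotheses on right translates of B.\<close>
  have w0: "w x \<noteq> 0" "w x \<noteq> \<infinity>" for x
    using pos[of "- x"] fin[of "- x"] unfolding w_eq by auto
  define F :: "'g \<Rightarrow> 'g \<Rightarrow> ennreal" where "F x y = indicator A x * indicator B (y + x) / w x" for x y
  have F[measurable]: "case_prod F \<in> borel_measurable (borel \<Otimes>\<^sub>M borel)"
    unfolding F_def by measurable
  have "emeasure \<mu> A = (\<integral>\<^sup>+ x. indicator A x \<partial>\<mu>)"
    by (simp add: s\<mu>)
  also have "\<dots> = (\<integral>\<^sup>+ x. \<integral>\<^sup>+ y. F x y \<partial>\<nu> \<partial>\<mu>)"
  proof (rule nn_integral_cong)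
    fix x
    have "(\<integral>\<^sup>+ y. F x y \<partial>\<nu>) = (\<integral>\<^sup>+ y. (indicator A x / w x) * indicator B (y + x) \<partial>\<nu>)"
      unfolding F_def by (intro nn_integral_cong) (simp add: divide_ennreal_def mult_ac)
    also have "\<dots> = (indicator A x / w x) * w x"
      unfolding w_def by (rule nn_integral_cmult) measurable
    also have "\<dots> = indicator A x"
      using w0[of x]
      by (cases "x \<in> A") (simp_all add: ennreal_divide_times ennreal_divide_self less_top)
    finally show "indicator A x = (\<integral>\<^sup>+ y. F x y \<partial>\<nu>)" ..
  qed
  also have "\<dots> = (\<integral>\<^sup>+ y. \<integral>\<^sup>+ x. F x y \<partial>\<mu> \<partial>\<nu>)"
    by (rule Fubini'[symmetric]) measurable
  also have "\<dots> = (\<integral>\<^sup>+ y. \<integral>\<^sup>+ x. F (- y + x) y \<partial>\<mu> \<partial>\<nu>)"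
    by (intro nn_integral_cong nn_integral_left_invariant[OF \<mu>(1), symmetric]) measurable
  also have "\<dots> = (\<integral>\<^sup>+ x. \<integral>\<^sup>+ y. F (- y + x) y \<partial>\<nu> \<partial>\<mu>)"
    by (rule Fubini') measurable
  also have "\<dots> = (\<integral>\<^sup>+ x. \<integral>\<^sup>+ y. F (- (x + y) + x) (x + y) \<partial>\<nu> \<partial>\<mu>)"
    by (intro nn_integral_cong nn_integral_left_invariant[OF \<nu>(1), symmetric]) measurable
  also have "\<dots> = (\<integral>\<^sup>+ x. (\<integral>\<^sup>+ y. indicator A (- y) / w (- y) \<partial>\<nu>) * indicator B x \<partial>\<mu>)"
  proof (rule nn_integral_cong)
    fix x
    \<comment> \<open>Here - (x + y) + x = - y, and the argument of the indicator of B becomes (x +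
      y) + (- y) = x.\<close>
    have "F (- (x + y) + x) (x + y) = indicator A (- y) / w (- y) * indicator B x" for y
      by (simp add: F_def minus_add add.assoc divide_ennreal_def mult_ac)
    then show "(\<integral>\<^sup>+ y. F (- (x + y) + x) (x + y) \<partial>\<nu>) =
        (\<integral>\<^sup>+ y. indicator A (- y) / w (- y) \<partial>\<nu>) * indicator B x"
      by (simp add: nn_integral_multc)
  qed
  also have "\<dots> = (\<integral>\<^sup>+ y. indicator A (- y) / w (- y) \<partial>\<nu>) * emeasure \<mu> B"
    by (simp add: nn_integral_cmult s\<mu>)
  finally show ?thesis .
qed

lemma haar_left_invariant: "left_haar_measure haar \<Longrightarrow> left_invariant haar"
  unfolding left_haar_measure_def left_invariant_def radon_measure_def borel_algebra_euclidean
  by blast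

lemma haar_open_pos:
  fixes haar :: "'g::{topological_group_add, second_countable_topology} measure"
  assumes "left_haar_measure haar" "open B" "B \<noteq> {}"
  shows "emeasure haar B \<noteq> 0"
  using assms(1) left_invariant_open_pos[OF haar_left_invariant _ assms(2,3), of haar]
  unfolding left_haar_measure_def by blast

lemma locally_compact_group_precompact_open:
  assumes "locally_compact_space (euclidean :: 'g::topological_group_add topology)"
  obtains B C :: "'g::topological_group_add set" where "open B" "0 \<in> B" "compact C" "B \<subseteq> C"
proof -
  have "\<exists>U K. open U \<and> compact K \<and> (0::'g) \<in> U \<and> U \<subseteq> K"
    using assms unfolding locally_compact_space_def
    by (auto simp flip: open_openin compactin_euclidean_iff)
  then show thesis using that by auto
qed

lemma haar_compact_finite: "left_haar_measure haar \<Longrightarrow> compact K \<Longrightarrow> emeasure haar K < \<infinity>"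
  unfolding left_haar_measure_def radon_measure_def compactin_euclidean_iff by blast

text \<open>A right translate \<mu> of \<open>haar\<close> is again left invariant because left and
  right translations commute. Factoring both measures against the same reference measure
  \<open>haar\<close> produces the same integral, whence D = \<mu>(B) / haar(B). Finiteness of D is
  recorded for the later limit in \<epsilon>.\<close>

lemma haar_right_translation:
  fixes haar :: "'g::{topological_group_add, t2_space, second_countable_topology} measure"
  assumes lc: "locally_compact_space (euclidean :: 'g topology)"
    and haar: "left_haar_measure haar"
  obtains D where "D \<noteq> \<infinity>"
    "\<And>A. A \<in> sets borel \<Longrightarrow> emeasure haar ((\<lambda>x. x + g) ` A) = D * emeasure haar A"
proof -
  obtain B C :: "'g set" where B: "open B" "0 \<in> B" and C: "compact C" "B \<subseteq> C"
    using locally_compact_group_precompact_open[OF lc] .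
  have Bne: "B \<noteq> {}" using B by auto
  note h = haar_left_invariant[OF haar]
  note sh[measurable_cong] = left_invariant_sets[OF h] and sp = left_invariant_space[OF h]
  \<comment> \<open>Left invariance says nothing about right translates of B; each is finite because
    it lies in a compact translate of C.\<close>
  have fin: "emeasure haar ((\<lambda>x. x + a) ` B) < \<infinity>" for a
  proof -
    have "compact ((\<lambda>x. x + a) ` C)"
      using C by (intro compact_continuous_image continuous_intros)
    then have c: "emeasure haar ((\<lambda>x. x + a) ` C) < \<infinity>" "(\<lambda>x. x + a) ` C \<in> sets borel"
      using haar_compact_finite[OF haar] by (auto intro: borel_compact)
    then have "emeasure haar ((\<lambda>x. x + a) ` B) \<le> emeasure haar ((\<lambda>x. x + a) ` C)"
      using C(2) sh by (intro emeasure_mono) auto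
    then show ?thesis using c(1) by (rule le_less_trans)
  qed
  have pos: "emeasure haar ((\<lambda>x. x + a) ` B) \<noteq> 0" for a
    using Bne B(1) by (intro haar_open_pos[OF haar] open_right_translation) auto
  have sfh: "sigma_finite_measure haar"
    using left_invariant_sigma_finite[OF h B(1) Bne] fin[of 0] by simp
  \<comment> \<open>The preimage of A under x - g is A + g, so this measure sends A to haar(A +
    g).\<close>
  define \<mu> where "\<mu> = distr haar borel (\<lambda>x. x + (- g))"
  have \<mu>_eq: "emeasure \<mu> A = emeasure haar ((\<lambda>x. x + g) ` A)" if "A \<in> sets borel" for A
    using that measurable_right_translation[of g] measurable_cong_sets[OF sh refl, of borel]
    unfolding \<mu>_def by (simp add: emeasure_distr image_right_translation sp)
  have \<mu>: "left_invariant \<mu>"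
    unfolding left_invariant_def
  proof (intro conjI allI ballI)
    fix a :: 'g and A :: "'g set" assume A: "A \<in> sets borel"
    have "emeasure \<mu> ((\<lambda>x. a + x) ` A) = emeasure haar ((\<lambda>x. a + x) ` (\<lambda>x. x + g) ` A)"
      using A by (simp add: \<mu>_eq borel_left_translation image_image add.assoc)
    also have "\<dots> = emeasure \<mu> A"
      using left_invariant_emeasure[OF h borel_right_translation[OF A]] A by (simp add: \<mu>_eq)
    finally show "emeasure \<mu> ((\<lambda>x. a + x) ` A) = emeasure \<mu> A" .
  qed (simp add: \<mu>_def)
  have Bb: "B \<in> sets borel" using B by simp
  have sf\<mu>: "sigma_finite_measure \<mu>"
    using left_invariant_sigma_finite[OF \<mu> B(1) Bne] fin[of g] Bb by (simp add: \<mu>_eq)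
  define c where "c = emeasure haar B"
  have c: "c \<noteq> 0" "c \<noteq> \<infinity>"
    using pos[of 0] fin[of 0] by (auto simp: c_def)
  show thesis
  proof (rule that[of "emeasure \<mu> B / c"])
    show "emeasure \<mu> B / c \<noteq> \<infinity>"
      using c fin[of g] Bb by (auto simp: \<mu>_eq divide_ennreal_def ennreal_mult_eq_top_iff)
  next
    fix A :: "'g set" assume A: "A \<in> sets borel"
    define I where
      "I = (\<integral>\<^sup>+ y. indicator A (- y) / (\<integral>\<^sup>+ t. indicator B (t + (- y)) \<partial>haar) \<partial>haar)"
    \<comment> \<open>\<open>I\<close> involves only A, B and the reference measure
      \<open>haar\<close>, so both factorisations share it.\<close>
    have I: "emeasure haar A = I * c" "emeasure \<mu> A = I * emeasure \<mu> B"
      unfolding I_def c_def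
      by (rule left_invariant_factor[OF _ _ h sfh Bb pos fin A]; fact)+
    have "emeasure \<mu> B / c * emeasure haar A = I * emeasure \<mu> B * (c / c)"
      unfolding I by (simp add: divide_ennreal_def mult_ac)
    also have "c / c = 1"
      using c by (simp add: ennreal_divide_self less_top)
    finally show "emeasure haar ((\<lambda>x. x + g) ` A) = emeasure \<mu> B / c * emeasure haar A"
      using I(2) \<mu>_eq[OF A] by simp
  qed
qed

section \<open>Charts of a local G-space\<close>

locale local_G =
  fixes M :: "'m topology" and \<alpha> :: "'m \<times> 'g::topological_group_add \<rightharpoonup> 'm"
  assumes local_G_space: "local_G_space M \<alpha>"
begin

lemma second_countable: "second_countable M"
  using local_G_space by (simp add: local_G_space_def lcsc_space_def)

lemma locally_compact: "neighbourhood_base_of (compactin M) M"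
  using local_G_space locally_compact_space_neighbourhood_base[of M]
  by (simp add: local_G_space_def lcsc_space_def)

lemma compactin_borel: "compactin M K \<Longrightarrow> K \<in> borel_algebra M"
proof -
  assume "compactin M K"
  then have K: "closedin M K"
    using local_G_space compactin_imp_closedin by (auto simp: local_G_space_def lcsc_space_def)
  interpret sigma_algebra "topspace M" "borel_algebra M"
    by (rule sigma_algebra_borel_algebra)
  have "topspace M - (topspace M - K) \<in> borel_algebra M"
    using K by (intro compl_sets borel_algebra_openin) auto
  then show ?thesis
    using closedin_subset[OF K] by (simp add: double_diff)
qed

lemma action: "partial_right_action M \<alpha>"
  using local_G_space by (simp add: local_G_space_def)

lemma openin_dom: "openin (prod_topology M euclidean) (dom \<alpha>)"
  and continuous_act:
    "continuous_map (subtopology (prod_topology M euclidean) (dom \<alpha>)) M (\<lambda>(p, g). act \<alpha> p g)"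
  and zero_dom: "p \<in> topspace M \<Longrightarrow> (p, 0) \<in> dom \<alpha>"
  and act_zero: "p \<in> topspace M \<Longrightarrow> act \<alpha> p 0 = p"
  using action unfolding partial_right_action_def by blast+

lemma dom_topspace: "(p, g) \<in> dom \<alpha> \<Longrightarrow> p \<in> topspace M"
  using openin_subset[OF openin_dom] by auto

lemma inverse_dom: "(p, g) \<in> dom \<alpha> \<Longrightarrow> (act \<alpha> p g, - g) \<in> dom \<alpha>"
  and act_inverse: "(p, g) \<in> dom \<alpha> \<Longrightarrow> act \<alpha> (act \<alpha> p g) (- g) = p"
  and act_add: "(p, g) \<in> dom \<alpha> \<Longrightarrow> (act \<alpha> p g, h) \<in> dom \<alpha> \<Longrightarrow> (p, g + h) \<in> dom \<alpha> \<Longrightarrow>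
      act \<alpha> p (g + h) = act \<alpha> (act \<alpha> p g) h"
  using action dom_topspace unfolding partial_right_action_def by blast+

lemma act_topspace: "(p, g) \<in> dom \<alpha> \<Longrightarrow> act \<alpha> p g \<in> topspace M"
  using inverse_dom dom_topspace by blast

lemma openin_preimage:
  assumes "openin M V" "continuous_map (subtopology M V) X k" "openin X W"
  shows "openin M {x \<in> V. k x \<in> W}"
proof -
  have "openin (subtopology M V) {x \<in> topspace (subtopology M V). k x \<in> W}"
    using assms(2,3) by (rule openin_continuous_map_preimage)
  moreover have "{x \<in> topspace (subtopology M V). k x \<in> W} = {x \<in> V. k x \<in> W}"
    using openin_subset[OF assms(1)] by auto
  ultimately show ?thesis
    using assms(1) by (simp only: openin_open_subtopology)
qed

lemma openin_preimage_open:
  "openin M V \<Longrightarrow> continuous_map (subtopology M V) euclidean k \<Longrightarrow> open W \<Longrightarrow> openin M {x \<in> V. k x \<in> W}"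
  by (rule openin_preimage[where X = euclidean]) auto

lemma openin_dom_preimage:
  assumes "openin M V" "continuous_map (subtopology M V) M a"
    "continuous_map (subtopology M V) euclidean k"
  shows "openin M {x \<in> V. (a x, k x) \<in> dom \<alpha>}"
  using assms openin_dom
  by (intro openin_preimage[where X = "prod_topology M euclidean"]) (auto simp: continuous_map_paired)

lemma chart_facts:
  assumes "chart M \<alpha> p V W f"
  shows chart_openin: "openin M V"
    and chart_open_range: "open W"
    and chart_continuous: "continuous_map (subtopology M V) euclidean f"
    and chart_image: "f ` V = W"
    and chart_inj: "inj_on f V"
    and chart_dom: "g \<in> W \<Longrightarrow> (p, g) \<in> dom \<alpha>"
    and chart_act: "x \<in> V \<Longrightarrow> act \<alpha> p (f x) = x"
    and chart_act_mem: "g \<in> W \<Longrightarrow> act \<alpha> p g \<in> V"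
    and chart_left_inv: "g \<in> W \<Longrightarrow> f (act \<alpha> p g) = g"
    and chart_zero: "0 \<in> W"
proof -
  have V: "openin M V" and W: "open W" and h: "homeomorphic_map (subtopology M V) (top_of_set W) f"
    and a: "\<And>g. g \<in> W \<Longrightarrow> (p, g) \<in> dom \<alpha> \<and> act \<alpha> p g \<in> V \<and> f (act \<alpha> p g) = g"
    using assms unfolding chart_def by blast+
  have top: "topspace (subtopology M V) = V"
    using openin_subset[OF V] by auto
  have im: "f ` V = W"
    using homeomorphic_imp_surjective_map[OF h] top by simp
  have inj: "inj_on f V"
    using homeomorphic_imp_injective_map[OF h] top by simp
  show "openin M V" "open W" "f ` V = W" "inj_on f V" by fact+
  show "0 \<in> W"
    using assms unfolding chart_def by blast
  show "continuous_map (subtopology M V) euclidean f"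
    using homeomorphic_imp_continuous_map[OF h] continuous_map_in_subtopology by blast
  show "g \<in> W \<Longrightarrow> (p, g) \<in> dom \<alpha>" "g \<in> W \<Longrightarrow> act \<alpha> p g \<in> V" "g \<in> W \<Longrightarrow> f (act \<alpha> p g) = g"
    using a by blast+
  \<comment> \<open>\<open>chart\<close> states that f inverts the orbit map on one side;
    injectivity of f gives the other side.\<close>
  show "act \<alpha> p (f x) = x" if "x \<in> V"
  proof (rule inj_onD[OF inj])
    have "f x \<in> W" using im that by blast
    then show "f (act \<alpha> p (f x)) = f x" "act \<alpha> p (f x) \<in> V" using a by blast+
  qed fact
qed

lemma chart_mem: "chart M \<alpha> p V W f \<Longrightarrow> x \<in> V \<Longrightarrow> f x \<in> W"
  using chart_image by fastforce

lemma chart_open_map: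
  assumes c: "chart M \<alpha> p V W f" and U: "openin M U" "U \<subseteq> V"
  shows "open (f ` U)"
proof -
  have "open_map (subtopology M V) (top_of_set W) f"
    using c unfolding chart_def by (intro homeomorphic_imp_open_map) blast
  moreover have "openin (subtopology M V) U"
    using U chart_openin[OF c] by (simp add: openin_open_subtopology)
  ultimately have "openin (top_of_set W) (f ` U)"
    by (simp add: open_map_def)
  then show ?thesis
    using chart_open_range[OF c] by (rule openin_open_trans)
qed

lemma chart_borel_image:
  assumes c: "chart M \<alpha> p V W f" and K: "K \<in> borel_algebra M" "K \<subseteq> V"
  shows "f ` K \<in> sets borel"
  unfolding borel_algebra_euclidean[symmetric]
  using borel_algebra_image[OF chart_openin[OF c] chart_inj[OF c], of euclidean] chart_open_map[OF c] K
  by auto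

lemma chart_inverse_image:
  assumes c: "chart M \<alpha> p V W f" and U: "open U" "U \<subseteq> W"
  shows "openin M {x \<in> V. f x \<in> U}" "f ` {x \<in> V. f x \<in> U} = U"
proof -
  show "openin M {x \<in> V. f x \<in> U}"
    using openin_preimage[OF chart_openin[OF c] chart_continuous[OF c]] U by simp
  show "f ` {x \<in> V. f x \<in> U} = U"
    using chart_image[OF c] U by blast
qed

text \<open>f vanishes at the centre, so shrinking the range to a neighbourhood of 0 keeps p in the
  domain. This yields ranges of finite Haar measure.\<close>

lemma chart_restrict:
  assumes c: "chart M \<alpha> p V W f" and W': "open W'" "0 \<in> W'" "W' \<subseteq> W"
  shows "chart M \<alpha> p {x \<in> V. f x \<in> W'} W' f"
proof -
  let ?V = "{x \<in> V. f x \<in> W'}"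
  have pV: "p \<in> V" and h: "homeomorphic_map (subtopology M V) (top_of_set W) f"
    using c unfolding chart_def by blast+
  have "act \<alpha> p 0 = p"
    using pV openin_subset[OF chart_openin[OF c]] by (intro act_zero) auto
  then have "f p = 0"
    using chart_left_inv[OF c chart_zero[OF c]] by simp
  have "homeomorphic_map (subtopology (subtopology M V) ?V) (subtopology (top_of_set W) W') f"
  proof (rule homeomorphic_map_subtopologies[OF h])
    show "f ` (topspace (subtopology M V) \<inter> ?V) = topspace (top_of_set W) \<inter> W'"
      using chart_image[OF c] W' openin_subset[OF chart_openin[OF c]] by fastforce
  qed
  moreover have "V \<inter> ?V = ?V" "W \<inter> W' = W'"
    using W' by auto
  ultimately have "homeomorphic_map (subtopology M ?V) (top_of_set W') f"
    by (simp add: subtopology_subtopology)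
  then show ?thesis
    unfolding chart_def
    using chart_inverse_image(1)[OF c W'(1,3)] W' pV \<open>f p = 0\<close> chart_dom[OF c]
      chart_act_mem[OF c] chart_left_inv[OF c] by auto
qed

text \<open>The inverse of the orbit homeomorphism supplied by homogeneity is a chart.\<close>

lemma chart_exists:
  assumes p: "p \<in> topspace M"
  obtains V W f where "chart M \<alpha> p V W f"
proof -
  obtain N V where N: "open N" "0 \<in> N" "{p} \<times> N \<subseteq> dom \<alpha>" and V: "openin M V" "p \<in> V"
      "homeomorphic_map (top_of_set N) (subtopology M V) (act \<alpha> p)"
    using local_G_space p unfolding local_G_space_def homogeneous_def orbit_map_homeo_def by meson
  obtain f where f: "homeomorphic_maps (top_of_set N) (subtopology M V) (act \<alpha> p) f"
    using V(3) homeomorphic_map_maps by blast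
  have "homeomorphic_map (subtopology M V) (top_of_set N) f"
    using f homeomorphic_maps_map by blast
  moreover have "act \<alpha> p g \<in> V \<and> f (act \<alpha> p g) = g" if "g \<in> N" for g
    using f that openin_subset[OF V(1)] unfolding homeomorphic_maps_def continuous_map_def
    by auto
  ultimately have "chart M \<alpha> p V N f"
    unfolding chart_def using N V by auto
  then show thesis by (rule that)
qed

lemma continuous_map_translate:
  assumes "continuous_map X euclidean k"
  shows "continuous_map X euclidean (\<lambda>x. a + k x + (b :: 'g))"
proof -
  have "continuous_map euclidean euclidean (\<lambda>y. a + y + b)"
    unfolding continuous_map_iff_continuous2 by (intro continuous_intros)
  from continuous_map_compose[OF assms this] show ?thesis
    by (simp add: o_def)
qed

text \<open>Near \<open>q\<close> every point is \<open>q.h\<close> with \<open>h\<close> small, and charts at \<open>p\<close> and \<open>p'\<close> send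
  \<open>q.h\<close> to \<open>f(q) h\<close> and \<open>f'(q) h\<close>: transition maps are locally left translations.\<close>

lemma chart_transition:
  assumes c: "chart M \<alpha> p V W f" and c': "chart M \<alpha> p' V' W' f'" and q: "q \<in> V" "q \<in> V'"
  obtains U where "openin M U" "q \<in> U" "U \<subseteq> V \<inter> V'" "\<And>x. x \<in> U \<Longrightarrow> f' x = f' q - f q + f x"
proof -
  let ?h = "\<lambda>x. - f q + f x"
  let ?k = "\<lambda>x. f' q - f q + f x"
  let ?V = "V \<inter> V'"
  have V: "openin M ?V"
    using chart_openin[OF c] chart_openin[OF c'] by blast
  have cf: "continuous_map (subtopology M ?V) euclidean f"
    using chart_continuous[OF c] by (rule continuous_map_from_subtopology_mono) auto
  have ch: "continuous_map (subtopology M ?V) euclidean ?h"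
    using continuous_map_translate[OF cf, of "- f q" 0] by simp
  have ck: "continuous_map (subtopology M ?V) euclidean ?k"
    using continuous_map_translate[OF cf, of "f' q - f q" 0] by simp
  \<comment> \<open>The composition law of a partial action holds only when all its terms are
    defined. The first condition makes q.(\<open>?h x\<close>) meaningful, the second puts (p',
    \<open>?k x\<close>) in the domain; at x = q they read (q, 0) \<in> dom \<alpha> and f' q \<in>
    W'.\<close>
  define U where "U = {x \<in> ?V. (q, ?h x) \<in> dom \<alpha>} \<inter> {x \<in> ?V. ?k x \<in> W'}"
  have qM: "q \<in> topspace M"
    using q openin_subset[OF chart_openin[OF c]] by auto
  show thesis
  proof (rule that)
    show "openin M U"
      unfolding U_def using chart_open_range[OF c'] qM
      by (intro openin_Int openin_dom_preimage openin_preimage_open V ch ck) auto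
    show "q \<in> U"
      using q chart_mem[OF c'] zero_dom[OF qM] by (simp add: U_def)
    show "U \<subseteq> ?V" by (auto simp: U_def)
    fix x assume "x \<in> U"
    then have x: "x \<in> V" "x \<in> V'" "(q, ?h x) \<in> dom \<alpha>" "?k x \<in> W'"
      by (auto simp: U_def)
    have "x = act \<alpha> p (f q + ?h x)"
      using chart_act[OF c x(1)] by (simp add: add.assoc[symmetric])
    also have "\<dots> = act \<alpha> (act \<alpha> p (f q)) (?h x)"
      using chart_act[OF c q(1)] chart_dom[OF c chart_mem[OF c q(1)]]
        chart_dom[OF c chart_mem[OF c x(1)]] x(3)
      by (intro act_add) (simp_all add: add.assoc[symmetric])
    also have "\<dots> = act \<alpha> (act \<alpha> p' (f' q)) (?h x)"
      using chart_act[OF c q(1)] chart_act[OF c' q(2)] by simp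
    also have "\<dots> = act \<alpha> p' (f' q + ?h x)"
      using chart_act[OF c' q(2)] chart_dom[OF c' chart_mem[OF c' q(2)]]
        chart_dom[OF c' x(4)] x(3)
      by (intro act_add[symmetric]) (simp_all add: add.assoc[symmetric])
    also have "f' q + ?h x = ?k x"
      by (simp add: add.assoc[symmetric])
    finally show "f' x = ?k x"
      using chart_left_inv[OF c' x(4)] by simp
  qed
qed

section \<open>The partial right translation by a fixed group element\<close>

lemma openin_translate_dom: "openin M {x \<in> topspace M. (x, g) \<in> dom \<alpha>}"
  by (rule openin_dom_preimage) auto

lemma inj_on_translate: "inj_on (\<lambda>x. act \<alpha> x g) {x \<in> topspace M. (x, g) \<in> dom \<alpha>}"
  by (rule inj_on_inverseI[of _ "\<lambda>y. act \<alpha> y (- g)"]) (simp add: act_inverse)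

text \<open>Translation by - g undoes translation by g, so the image of U is the preimage of U under
  a continuous map with open domain.\<close>

lemma translate_open_map:
  assumes U: "openin M U" "U \<subseteq> {x \<in> topspace M. (x, g) \<in> dom \<alpha>}"
  shows "openin M ((\<lambda>x. act \<alpha> x g) ` U)"
proof -
  let ?V = "{x \<in> topspace M. (x, - g) \<in> dom \<alpha>}"
  have "continuous_map (subtopology M ?V) (subtopology (prod_topology M euclidean) (dom \<alpha>)) (\<lambda>x. (x, - g))"
    unfolding continuous_map_in_subtopology by (auto simp: continuous_map_paired)
  from continuous_map_compose[OF this continuous_act]
  have "continuous_map (subtopology M ?V) M (\<lambda>x. act \<alpha> x (- g))"
    by (simp add: o_def)
  from openin_preimage[OF openin_translate_dom this U(1)]
  have "openin M {x \<in> ?V. act \<alpha> x (- g) \<in> U}" .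
  moreover have "(\<lambda>x. act \<alpha> x g) ` U = {x \<in> ?V. act \<alpha> x (- g) \<in> U}"
  proof (intro equalityI subsetI)
    fix y assume "y \<in> (\<lambda>x. act \<alpha> x g) ` U"
    then obtain x where x: "x \<in> U" "y = act \<alpha> x g" by blast
    then have "(x, g) \<in> dom \<alpha>" using U(2) by blast
    then show "y \<in> {x \<in> ?V. act \<alpha> x (- g) \<in> U}"
      using x inverse_dom act_inverse act_topspace by simp
  next
    fix y assume y: "y \<in> {x \<in> ?V. act \<alpha> x (- g) \<in> U}"
    then have "act \<alpha> (act \<alpha> y (- g)) (- (- g)) = y"
      by (intro act_inverse) auto
    then show "y \<in> (\<lambda>x. act \<alpha> x g) ` U"
      using y by (intro image_eqI[of _ _ "act \<alpha> y (- g)"]) auto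
  qed
  ultimately show ?thesis by simp
qed

text \<open>Writing x = p.(f x) gives x.g = p.(f x + g) = (p.g).(- g + f x + g), and the chart f'
  centred at p.g reads off the last element.\<close>

lemma translate_chart:
  assumes c: "chart M \<alpha> p V W f" and pg: "(p, g) \<in> dom \<alpha>"
    and c': "chart M \<alpha> (act \<alpha> p g) V' W' f'"
  obtains U where "openin M U" "p \<in> U" "U \<subseteq> {x \<in> V. (x, g) \<in> dom \<alpha>}"
    "\<And>x. x \<in> U \<Longrightarrow> act \<alpha> x g \<in> V'" "\<And>x. x \<in> U \<Longrightarrow> f' (act \<alpha> x g) = - g + f x + g"
proof -
  let ?k = "\<lambda>x. - g + f x + g"
  have pV: "p \<in> V" using c unfolding chart_def by blast
  have pM: "p \<in> topspace M" using pg by (rule dom_topspace)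
  have fp: "f p = 0"
    using chart_left_inv[OF c chart_zero[OF c]] act_zero[OF pM] by simp
  have ck: "continuous_map (subtopology M V) euclidean ?k"
    by (rule continuous_map_translate[OF chart_continuous[OF c]])
  have cg: "continuous_map (subtopology M V) euclidean (\<lambda>x. f x + g)"
    using continuous_map_translate[OF chart_continuous[OF c], of 0 g] by simp
  \<comment> \<open>These conditions license both uses of the composition law: x.g and p.(f x + g)
    are defined, and the new coordinate lies in the range of f'.\<close>
  define U where "U = {x \<in> V. (x, g) \<in> dom \<alpha>} \<inter> {x \<in> V. (p, f x + g) \<in> dom \<alpha>} \<inter> {x \<in> V. ?k x \<in> W'}"
  have U: "act \<alpha> x g = act \<alpha> (act \<alpha> p g) (?k x)" if "x \<in> U" for x
  proof -
    from that have x: "x \<in> V" "(x, g) \<in> dom \<alpha>" "(p, f x + g) \<in> dom \<alpha>" "?k x \<in> W'"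
      by (auto simp: U_def)
    have "act \<alpha> x g = act \<alpha> (act \<alpha> p (f x)) g"
      using chart_act[OF c x(1)] by simp
    also have "\<dots> = act \<alpha> p (f x + g)"
      using chart_act[OF c x(1)] chart_dom[OF c chart_mem[OF c x(1)]] x
      by (intro act_add[symmetric]) simp_all
    also have "f x + g = g + ?k x"
      by (simp add: add.assoc[symmetric])
    also have "act \<alpha> p (g + ?k x) = act \<alpha> (act \<alpha> p g) (?k x)"
      using pg chart_dom[OF c' x(4)] x(3)
      by (intro act_add) (simp_all add: add.assoc[symmetric])
    finally show ?thesis .
  qed
  show thesis
  proof (rule that)
    show "openin M U"
      unfolding U_def using chart_open_range[OF c'] pM
      by (intro openin_Int openin_dom_preimage openin_preimage_open chart_openin[OF c] ck cg) auto
    show "p \<in> U"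
      using pV pg fp chart_zero[OF c'] by (simp add: U_def)
    show "U \<subseteq> {x \<in> V. (x, g) \<in> dom \<alpha>}" by (auto simp: U_def)
    fix x assume x: "x \<in> U"
    then have "?k x \<in> W'" by (simp add: U_def)
    then show "act \<alpha> x g \<in> V'" "f' (act \<alpha> x g) = ?k x"
      using U[OF x] chart_act_mem[OF c'] chart_left_inv[OF c'] by auto
  qed
qed

end

section \<open>The canonical measure\<close>

text \<open>The property inside the definite description of \<open>vol\<close>, named so that
  existence and uniqueness can be stated.\<close>

definition canonical_measure ::
    "'g::topological_group_add measure \<Rightarrow> 'm topology \<Rightarrow> ('m \<times> 'g \<rightharpoonup> 'm) \<Rightarrow> 'm measure \<Rightarrow> bool" where
  "canonical_measure haar M \<alpha> \<nu> \<longleftrightarrow> radon_measure M \<nu> \<and>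
     (\<forall>p V W f K. chart M \<alpha> p V W f \<and> K \<in> borel_algebra M \<and> K \<subseteq> V \<longrightarrow>
        emeasure \<nu> K = emeasure haar (f ` K))"

lemma sets_canonical: "canonical_measure haar M \<alpha> \<nu> \<Longrightarrow> sets \<nu> = borel_algebra M"
  unfolding canonical_measure_def radon_measure_def by (elim conjE)

lemma emeasure_canonical:
  "canonical_measure haar M \<alpha> \<nu> \<Longrightarrow> chart M \<alpha> p V W f \<Longrightarrow> K \<in> borel_algebra M \<Longrightarrow> K \<subseteq> V \<Longrightarrow>
    emeasure \<nu> K = emeasure haar (f ` K)"
  unfolding canonical_measure_def by blast

locale haar_local_G = local_G M \<alpha>
  for M :: "'m topology"
    and \<alpha> :: "'m \<times> 'g::{topological_group_add, t2_space, second_countable_topology} \<rightharpoonup> 'm" +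
  fixes haar :: "'g measure"
  assumes locally_compact_group: "locally_compact_space (euclidean :: 'g topology)"
    and haar: "left_haar_measure haar"
begin

lemma sets_haar: "sets haar = sets borel"
  by (rule left_invariant_sets[OF haar_left_invariant[OF haar]])

lemma chart_countably_additive:
  assumes c: "chart M \<alpha> p V W f"
  shows "countably_additive {K \<in> borel_algebra M. K \<subseteq> V} (\<lambda>K. emeasure haar (f ` K))"
  using chart_inj[OF c] chart_borel_image[OF c]
  by (intro countably_additive_image[of f V]) (auto simp: sets_haar)

text \<open>Near a common point q the charts differ by the left translation by f' q - f q, which
  \<open>haar\<close> ignores. That element depends on q, so the equality is first local and then
  globalised.\<close>

lemma chart_emeasure_eq:
  assumes c: "chart M \<alpha> p V W f" and c': "chart M \<alpha> p' V' W' f'"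
    and K: "K \<in> borel_algebra M" "K \<subseteq> V" "K \<subseteq> V'"
  shows "emeasure haar (f ` K) = emeasure haar (f' ` K)"
proof (rule countably_additive_eq_if_locally_eq[OF second_countable, where S = "V \<inter> V'" and A = K])
  show "openin M (V \<inter> V')"
    using chart_openin[OF c] chart_openin[OF c'] by blast
  show "countably_additive {K \<in> borel_algebra M. K \<subseteq> V \<inter> V'} (\<lambda>K. emeasure haar (f ` K))"
    by (rule countably_additive_restrict[OF chart_countably_additive[OF c]]) auto
  show "countably_additive {K \<in> borel_algebra M. K \<subseteq> V \<inter> V'} (\<lambda>K. emeasure haar (f' ` K))"
    by (rule countably_additive_restrict[OF chart_countably_additive[OF c']]) auto
  fix q assume "q \<in> V \<inter> V'"
  then have q: "q \<in> V" "q \<in> V'" by auto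
  obtain U where U: "openin M U" "q \<in> U" "U \<subseteq> V \<inter> V'"
      "\<And>x. x \<in> U \<Longrightarrow> f' x = f' q - f q + f x"
    by (rule chart_transition[OF c c' q]) blast
  have "emeasure haar (f ` L) = emeasure haar (f' ` L)" if L: "L \<in> borel_algebra M" "L \<subseteq> U" for L
  proof -
    have "f' ` L = (\<lambda>y. f' q - f q + y) ` f ` L"
      unfolding image_image using U(4) L(2) by (intro image_cong) auto
    moreover have "f ` L \<in> sets borel"
      using L U(3) by (intro chart_borel_image[OF c]) auto
    ultimately show ?thesis
      by (simp add: left_invariant_emeasure[OF haar_left_invariant[OF haar]])
  qed
  then show "\<exists>U. openin M U \<and> q \<in> U \<and>
      (\<forall>K \<in> borel_algebra M. K \<subseteq> U \<longrightarrow> emeasure haar (f ` K) = emeasure haar (f' ` K))"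
    using U(1,2) by blast
qed (use K in auto)

text \<open>The range is cut down to a subset of a compact set. Finite ranges serve finiteness on
  compact sets and outer regularity of the glued measure.\<close>

lemma chart_finite_exists:
  assumes p: "p \<in> topspace M"
  obtains V W f where "chart M \<alpha> p V W f" "emeasure haar W < \<infinity>"
proof -
  obtain V W f where c: "chart M \<alpha> p V W f"
    using chart_exists[OF p] .
  obtain B C :: "'g set" where B: "open B" "0 \<in> B" "compact C" "B \<subseteq> C"
    using locally_compact_group_precompact_open[OF locally_compact_group] .
  have "chart M \<alpha> p {x \<in> V. f x \<in> W \<inter> B} (W \<inter> B) f"
    using B chart_open_range[OF c] chart_zero[OF c] by (intro chart_restrict[OF c]) auto
  moreover have "emeasure haar (W \<inter> B) \<le> emeasure haar C"
    using B by (intro emeasure_mono) (auto simp: sets_haar intro: borel_compact)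
  then have "emeasure haar (W \<inter> B) < \<infinity>"
    using haar_compact_finite[OF haar B(3)] by (rule le_less_trans)
  ultimately show thesis by (rule that)
qed

lemma canonical_countably_additive:
  assumes \<nu>: "canonical_measure haar M \<alpha> \<nu>"
  shows "countably_additive {K \<in> borel_algebra M. K \<subseteq> S} (emeasure \<nu>)"
  using countably_additive_image[of id S "{K \<in> borel_algebra M. K \<subseteq> S}" \<nu>]
  by (simp add: sets_canonical[OF \<nu>])

text \<open>Both measures are prescribed inside chart domains, and these cover M.\<close>

lemma canonical_unique:
  assumes \<nu>: "canonical_measure haar M \<alpha> \<nu>" and \<nu>': "canonical_measure haar M \<alpha> \<nu>'"
  shows "\<nu> = \<nu>'"
proof (rule measure_eqI)
  show "sets \<nu> = sets \<nu>'"
    using \<nu> \<nu>' by (simp add: sets_canonical)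
  fix A assume "A \<in> sets \<nu>"
  then have A: "A \<in> borel_algebra M" using \<nu> by (simp add: sets_canonical)
  show "emeasure \<nu> A = emeasure \<nu>' A"
  proof (rule countably_additive_eq_if_locally_eq[OF second_countable openin_topspace
        canonical_countably_additive[OF \<nu>] canonical_countably_additive[OF \<nu>'] _ _ A])
    show "A \<subseteq> topspace M"
      using A by (rule borel_algebra_subset)
    fix p assume "p \<in> topspace M"
    then obtain V W f where c: "chart M \<alpha> p V W f" by (rule chart_exists)
    have "p \<in> V" using c unfolding chart_def by blast
    then show "\<exists>V. openin M V \<and> p \<in> V \<and> (\<forall>K\<in>borel_algebra M. K \<subseteq> V \<longrightarrow> emeasure \<nu> K = emeasure \<nu>' K)"
      using chart_openin[OF c] emeasure_canonical[OF \<nu> c] emeasure_canonical[OF \<nu>' c] by (intro exI[of _ V]) auto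
  qed simp
qed

text \<open>The measure is glued: the disjointed domains D n split M, and m n A is the Haar measure
  of the part of A in D n, read in chart n. Independence of the chart gives the prescribed value in
  every chart; outer regularity is inherited from \<open>haar\<close>, inner regularity comes from
  local compactness of M.\<close>

lemma canonical_exists_atlas:
  fixes p :: "nat \<Rightarrow> 'm"
  assumes c: "\<And>n. chart M \<alpha> (p n) (V n) (W n) (f n)" and fin: "\<And>n. emeasure haar (W n) < \<infinity>"
    and cover: "topspace M \<subseteq> (\<Union>n. V n)"
  shows "\<exists>\<nu>. canonical_measure haar M \<alpha> \<nu>"
proof -
  interpret B: sigma_algebra "topspace M" "borel_algebra M"
    by (rule sigma_algebra_borel_algebra)
  define D where "D = disjointed V"
  define m where "m n A = emeasure haar (f n ` (A \<inter> D n))" for n A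
  define \<nu> where "\<nu> = measure_of (topspace M) {U. openin M U} (\<lambda>A. \<Sum>n. m n A)"
  have Pow: "{U. openin M U} \<subseteq> Pow (topspace M)"
    by (auto dest: openin_subset)
  have sets: "sets \<nu> = borel_algebra M" and space: "space \<nu> = topspace M"
    using Pow by (simp_all add: \<nu>_def borel_algebra_def)
  have D: "D n \<in> borel_algebra M" "D n \<subseteq> V n" for n
    using borel_algebra_disjointed[of M V] chart_openin[OF c] disjointed_subset[of V n]
    by (auto simp: D_def)
  have UD: "A \<subseteq> (\<Union>n. D n)" if "A \<subseteq> topspace M" for A
    using that cover unfolding D_def UN_disjointed_eq by blast
  have djD: "disjoint_family D"
    unfolding D_def by (rule disjoint_family_disjointed)
  have AD: "A \<inter> D n \<in> borel_algebra M" "A \<inter> D n \<subseteq> V n" if "A \<in> borel_algebra M" for A n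
    using that D[of n] by auto
  have ca: "(\<Sum>i. m n (A i)) = m n (\<Union>i. A i)"
    if "range A \<subseteq> borel_algebra M" "disjoint_family A" for n and A :: "nat \<Rightarrow> 'm set"
  proof -
    have rg: "range (\<lambda>i. A i \<inter> D n) \<subseteq> {K \<in> borel_algebra M. K \<subseteq> V n}"
      using AD[of "A _" n] that(1) by blast
    have dj: "disjoint_family (\<lambda>i. A i \<inter> D n)"
      using that(2) unfolding disjoint_family_on_def by blast
    have un: "(\<Union>i. A i \<inter> D n) = (\<Union>i. A i) \<inter> D n" by blast
    have "(\<Union>i. A i \<inter> D n) \<in> {K \<in> borel_algebra M. K \<subseteq> V n}"
      using AD[of "\<Union>i. A i" n] that(1) unfolding un by blast
    from chart_countably_additive[OF c, unfolded countably_additive_def, rule_format, OF rg dj this]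
    show ?thesis
      unfolding m_def un .
  qed
  \<comment> \<open>\<open>measure_of\<close> falls back to the zero measure unless its function is
    positive and countably additive; the latter is additivity on each piece followed by an exchange
    of sums.\<close>
  have em: "emeasure \<nu> A = (\<Sum>n. m n A)" if "A \<in> borel_algebra M" for A
  proof (rule emeasure_measure_of[OF \<nu>_def Pow])
    show "positive (sets \<nu>) (\<lambda>A. \<Sum>n. m n A)"
      by (simp add: positive_def m_def)
    show "countably_additive (sets \<nu>) (\<lambda>A. \<Sum>n. m n A)"
    proof (rule countably_additiveI)
      fix A :: "nat \<Rightarrow> 'm set" assume "range A \<subseteq> sets \<nu>" "disjoint_family A"
      then show "(\<Sum>i. \<Sum>n. m n (A i)) = (\<Sum>n. m n (\<Union>i. A i))"
        using ca[of A] suminf_swap_ennreal[of "\<lambda>i n. m n (A i)"] by (simp add: sets)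
    qed
    show "A \<in> sets \<nu>" using that by (simp add: sets)
  qed
  \<comment> \<open>On K \<inter> D n the chart f n may be replaced by g; then all pieces are read
    in one chart and add up.\<close>
  have ch: "emeasure \<nu> K = emeasure haar (g ` K)"
    if cg: "chart M \<alpha> q X Y g" and K: "K \<in> borel_algebra M" "K \<subseteq> X" for q X Y g K
  proof -
    have "emeasure \<nu> K = (\<Sum>n. emeasure haar (g ` (K \<inter> D n)))"
      unfolding em[OF K(1)] m_def
    proof (rule arg_cong[where f = suminf], rule ext)
      fix n
      show "emeasure haar (f n ` (K \<inter> D n)) = emeasure haar (g ` (K \<inter> D n))"
        using AD[OF K(1), of n] K(2) by (intro chart_emeasure_eq[OF c cg]) auto
    qed
    also have "\<dots> = emeasure haar (g ` (\<Union>n. K \<inter> D n))"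
    proof (rule chart_countably_additive[OF cg, unfolded countably_additive_def, rule_format])
      show "range (\<lambda>n. K \<inter> D n) \<subseteq> {K \<in> borel_algebra M. K \<subseteq> X}"
        using AD(1)[OF K(1)] K(2) by auto
      then show "(\<Union>n. K \<inter> D n) \<in> {K \<in> borel_algebra M. K \<subseteq> X}"
        by blast
      show "disjoint_family (\<lambda>n. K \<inter> D n)"
        using djD unfolding disjoint_family_on_def by blast
    qed
    also have "(\<Union>n. K \<inter> D n) = K"
      using UD[of K] borel_algebra_subset[OF K(1)] by blast
    finally show ?thesis .
  qed
  have V: "emeasure \<nu> (V n) < \<infinity>" "V n \<in> sets \<nu>" for n
    using ch[OF c[of n], of "V n"] fin[of n] chart_image[OF c[of n]] chart_openin[OF c[of n]]
    by (auto simp: sets borel_algebra_openin)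
  have compact: "emeasure \<nu> K < \<infinity>" if K: "compactin M K" for K
  proof -
    have "K \<subseteq> \<Union> (range V)" "\<forall>U\<in>range V. openin M U"
      using K cover chart_openin[OF c] unfolding compactin_def by auto
    then obtain \<F> where "finite \<F>" "\<F> \<subseteq> range V" "K \<subseteq> \<Union>\<F>"
      using K unfolding compactin_def by blast
    moreover from this obtain I where "finite I" "\<F> = V ` I"
      using finite_subset_image[of \<F> V UNIV] by blast
    ultimately have I: "finite I" "K \<subseteq> (\<Union>n\<in>I. V n)"
      by simp_all
    have "emeasure \<nu> K \<le> emeasure \<nu> (\<Union>n\<in>I. V n)"
      using I V(2) by (intro emeasure_mono) auto
    also have "\<dots> \<le> (\<Sum>n\<in>I. emeasure \<nu> (V n))"
      using I V(2) by (intro emeasure_subadditive_finite) auto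
    also have "\<dots> < \<infinity>"
      using I V(1) by simp
    finally show ?thesis .
  qed
  have outer: "emeasure \<nu> A = (INF U \<in> {U. openin M U \<and> A \<subseteq> U}. emeasure \<nu> U)"
    if A: "A \<in> sets \<nu>" for A
  proof (rule antisym)
    show "emeasure \<nu> A \<le> (INF U \<in> {U. openin M U \<and> A \<subseteq> U}. emeasure \<nu> U)"
      by (intro INF_greatest emeasure_mono) (auto simp: sets borel_algebra_openin)
    show "(INF U \<in> {U. openin M U \<and> A \<subseteq> U}. emeasure \<nu> U) \<le> emeasure \<nu> A"
    proof (rule ennreal_le_epsilon)
      fix e :: real assume e: "0 < e"
      \<comment> \<open>The error allowed in chart n; the exponent \<open>Suc n\<close> makes the
        total exactly e.\<close>
      define \<delta> where "\<delta> n = e * (1 / 2) ^ Suc n" for n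
      have \<delta>: "0 < \<delta> n" for n using e by (simp add: \<delta>_def)
      define X where "X n = f n ` (A \<inter> D n)" for n
      have A': "A \<in> borel_algebra M" using A by (simp add: sets)
      have X: "X n \<in> sets haar" "X n \<subseteq> W n" for n
        using AD[OF A', of n] chart_borel_image[OF c[of n]] chart_image[OF c[of n]]
        by (auto simp: X_def sets_haar)
      \<comment> \<open>Outer regularity of \<open>haar\<close> at the chart image X n. The strict
        inequality relies on X n having finite measure, as it lies in W n.\<close>
      have "\<exists>Y. open Y \<and> X n \<subseteq> Y \<and> emeasure haar Y < emeasure haar (X n) + ennreal (\<delta> n)" for n
      proof -
        have "emeasure haar (X n) \<le> emeasure haar (W n)"
          using X chart_open_range[OF c[of n]] by (intro emeasure_mono) (auto simp: sets_haar)
        then have "emeasure haar (X n) \<noteq> \<infinity>"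
          using fin[of n] by auto
        then have "emeasure haar (X n) < emeasure haar (X n) + ennreal (\<delta> n)"
          using \<delta>[of n] by (cases "emeasure haar (X n)") (auto simp flip: ennreal_plus intro!: ennreal_lessI)
        moreover have "emeasure haar (X n) = (INF U \<in> {U. openin euclidean U \<and> X n \<subseteq> U}. emeasure haar U)"
          using haar X(1) unfolding left_haar_measure_def radon_measure_def by blast
        ultimately have "(INF U \<in> {U. openin euclidean U \<and> X n \<subseteq> U}. emeasure haar U)
            < emeasure haar (X n) + ennreal (\<delta> n)"
          by (simp only:)
        then show ?thesis
          unfolding INF_less_iff by auto
      qed
      then have "\<forall>n. \<exists>Y. open Y \<and> X n \<subseteq> Y \<and> emeasure haar Y < emeasure haar (X n) + ennreal (\<delta> n)"
        by blast
      then obtain Y where Y': "\<forall>n. open (Y n) \<and> X n \<subseteq> Y n \<and>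
          emeasure haar (Y n) < emeasure haar (X n) + ennreal (\<delta> n)"
        unfolding choice_iff ..
      then have Y: "open (Y n)" "X n \<subseteq> Y n" "emeasure haar (Y n) < emeasure haar (X n) + ennreal (\<delta> n)" for n
        by blast+
      define U where "U n = {x \<in> V n. f n x \<in> Y n \<inter> W n}" for n
      have op: "open (Y n \<inter> W n)" for n
        using Y(1) chart_open_range[OF c] by blast
      have U: "openin M (U n)" "f n ` U n = Y n \<inter> W n" for n
        using chart_inverse_image[OF c op] by (auto simp: U_def)
      have AU: "A \<subseteq> (\<Union>n. U n)"
      proof
        fix x assume "x \<in> A"
        then obtain n where n: "x \<in> A \<inter> D n"
          using UD borel_algebra_subset[OF A'] by blast
        then have "f n x \<in> X n" "x \<in> V n" using D(2) by (auto simp: X_def)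
        then show "x \<in> (\<Union>n. U n)"
          using X(2)[of n] Y(2)[of n] by (auto simp: U_def)
      qed
      have "(INF U \<in> {U. openin M U \<and> A \<subseteq> U}. emeasure \<nu> U) \<le> emeasure \<nu> (\<Union>n. U n)"
        using U(1) AU by (intro INF_lower) auto
      also have "\<dots> \<le> (\<Sum>n. emeasure \<nu> (U n))"
        using U(1) by (intro emeasure_subadditive_countably) (auto simp: sets borel_algebra_openin)
      also have "\<dots> \<le> (\<Sum>n. emeasure haar (X n) + ennreal (\<delta> n))"
      proof (rule suminf_le)
        fix n
        have "emeasure \<nu> (U n) = emeasure haar (Y n \<inter> W n)"
          using ch[OF c[of n], of "U n"] U[of n] by (auto simp: U_def borel_algebra_openin)
        also have "\<dots> \<le> emeasure haar (Y n)"
          using Y(1) by (intro emeasure_mono) (auto simp: sets_haar)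
        also have "\<dots> \<le> emeasure haar (X n) + ennreal (\<delta> n)"
          using Y(3)[of n] by simp
        finally show "emeasure \<nu> (U n) \<le> emeasure haar (X n) + ennreal (\<delta> n)" .
      qed auto
      also have "\<dots> = (\<Sum>n. emeasure haar (X n)) + (\<Sum>n. ennreal (\<delta> n))"
        by (rule suminf_add[symmetric]) auto
      also have "(\<Sum>n. ennreal (\<delta> n)) = ennreal e"
        using sums_mult[OF power_half_series, of e] less_imp_le[OF \<delta>]
        by (intro suminf_ennreal_eq) (auto simp: \<delta>_def)
      also have "(\<Sum>n. emeasure haar (X n)) = emeasure \<nu> A"
        by (simp add: em[OF A'] m_def X_def)
      finally show "(INF U \<in> {U. openin M U \<and> A \<subseteq> U}. emeasure \<nu> U) \<le> emeasure \<nu> A + ennreal e" .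
    qed
  qed
  have inner: "emeasure \<nu> U = (SUP K \<in> {K. compactin M K \<and> K \<subseteq> U}. emeasure \<nu> K)"
    if U: "openin M U" for U
  proof (rule antisym)
    show "(SUP K \<in> {K. compactin M K \<and> K \<subseteq> U}. emeasure \<nu> K) \<le> emeasure \<nu> U"
      using U by (intro SUP_least emeasure_mono) (auto simp: sets borel_algebra_openin)
    show "emeasure \<nu> U \<le> (SUP K \<in> {K. compactin M K \<and> K \<subseteq> U}. emeasure \<nu> K)"
    proof (cases "U = {}")
      case False
      \<comment> \<open>Local compactness and second countability make U a countable union of
        compact sets; their finite unions increase to U, and continuity from below gives the
        supremum.\<close>
      have nhd: "\<exists>V. openin M V \<and> x \<in> V \<and> (\<exists>K. compactin M K \<and> V \<subseteq> K \<and> K \<subseteq> U)" if "x \<in> U" for x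
        using locally_compact U that unfolding neighbourhood_base_of by meson
      obtain Z :: "nat \<Rightarrow> 'm set"
        where "\<And>n. openin M (Z n)"
          and Z: "\<And>n. \<exists>K. compactin M K \<and> Z n \<subseteq> K \<and> K \<subseteq> U" "U \<subseteq> (\<Union>n. Z n)"
      proof (rule second_countable_cover[OF second_countable False nhd])
        fix Z :: "nat \<Rightarrow> 'm set"
        assume "\<And>n. openin M (Z n)" "U \<subseteq> (\<Union>n. Z n)"
          "\<And>n. \<exists>K. compactin M K \<and> Z n \<subseteq> K \<and> K \<subseteq> U"
        then show thesis by (intro that)
      qed
      have "\<forall>n. \<exists>K. compactin M K \<and> Z n \<subseteq> K \<and> K \<subseteq> U"
        by (intro allI Z)
      then obtain K where "\<forall>n. compactin M (K n) \<and> Z n \<subseteq> K n \<and> K n \<subseteq> U"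
        unfolding choice_iff ..
      then have K: "compactin M (K n)" "Z n \<subseteq> K n" "K n \<subseteq> U" for n
        by blast+
      define L where "L n = (\<Union>i\<le>n. K i)" for n
      have L: "compactin M (L n)" "L n \<subseteq> U" for n
      proof -
        show "compactin M (L n)"
          unfolding L_def by (intro compactin_Union) (auto intro: K(1))
        show "L n \<subseteq> U"
          unfolding L_def by (intro UN_least K(3))
      qed
      have "Z n \<subseteq> L n" for n
        using K(2)[of n] by (auto simp: L_def)
      then have "U \<subseteq> (\<Union>n. L n)"
        by (intro order_trans[OF Z(2)] UN_mono) auto
      then have "U = (\<Union>n. L n)"
        by (intro antisym UN_least L(2))
      moreover have "incseq L"
        unfolding incseq_def L_def by (intro allI impI UN_mono) auto
      ultimately have "emeasure \<nu> U = (SUP n. emeasure \<nu> (L n))"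
        using SUP_emeasure_incseq[of L \<nu>] compactin_borel[OF L(1)]
        by (simp add: sets image_subset_iff)
      also have "\<dots> \<le> (SUP K \<in> {K. compactin M K \<and> K \<subseteq> U}. emeasure \<nu> K)"
        using L by (intro SUP_mono) blast
      finally show ?thesis .
    qed simp
  qed
  have "canonical_measure haar M \<alpha> \<nu>"
    unfolding canonical_measure_def radon_measure_def
  proof (intro conjI allI impI ballI)
    show "space \<nu> = topspace M" "sets \<nu> = borel_algebra M" by fact+
    show "emeasure \<nu> K < \<infinity>" if "compactin M K" for K
      using that by (rule compact)
    show "emeasure \<nu> A = (INF U \<in> {U. openin M U \<and> A \<subseteq> U}. emeasure \<nu> U)" if "A \<in> sets \<nu>" for A
      using that by (rule outer)
    show "emeasure \<nu> U = (SUP K \<in> {K. compactin M K \<and> K \<subseteq> U}. emeasure \<nu> K)" if "openin M U" for U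
      using that by (rule inner)
    show "emeasure \<nu> K = emeasure haar (g ` K)"
      if "chart M \<alpha> q X Y g \<and> K \<in> borel_algebra M \<and> K \<subseteq> X" for q X Y g K
      using that by (elim conjE) (rule ch)
  qed
  then show ?thesis ..
qed

lemma canonical_exists: "\<exists>\<nu>. canonical_measure haar M \<alpha> \<nu>"
proof (cases "topspace M = {}")
  \<comment> \<open>Without points there are no charts to enumerate; \<open>sigma\<close> carries
    the zero measure, which is canonical here.\<close>
  case True
  define \<nu> :: "'m measure" where "\<nu> = sigma (topspace M) {U. openin M U}"
  have Pow: "{U. openin M U} \<subseteq> Pow (topspace M)"
    by (auto dest: openin_subset)
  have sets: "sets \<nu> = borel_algebra M" and space: "space \<nu> = topspace M"
    using Pow by (simp_all add: \<nu>_def borel_algebra_def)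
  have em: "emeasure \<nu> A = 0" for A
    by (simp add: \<nu>_def emeasure_sigma)
  have "emeasure \<nu> A = (INF U \<in> {U. openin M U \<and> A \<subseteq> U}. emeasure \<nu> U)" if "A \<in> sets \<nu>" for A
  proof -
    have "A \<subseteq> topspace M" using sets.sets_into_space[OF that] by (simp only: space)
    \<comment> \<open>An infimum over the empty set would be infinite instead of 0.\<close>
    then have "{U. openin M U \<and> A \<subseteq> U} \<noteq> {}" by blast
    then show ?thesis unfolding em by simp
  qed
  moreover have "emeasure \<nu> U = (SUP K \<in> {K. compactin M K \<and> K \<subseteq> U}. emeasure \<nu> K)" for U
  proof -
    have "{K. compactin M K \<and> K \<subseteq> U} \<noteq> {}" by (auto intro!: exI[of _ "{}"])
    then show ?thesis unfolding em by simp
  qed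
  moreover have "\<not> chart M \<alpha> p V W f" for p V W f
    using True openin_subset unfolding chart_def by blast
  moreover have "emeasure \<nu> K < \<infinity>" for K
    unfolding em by simp
  ultimately have "canonical_measure haar M \<alpha> \<nu>"
    unfolding canonical_measure_def radon_measure_def using sets space by blast
  then show ?thesis ..
next
  case False
  have nhd: "\<exists>V. openin M V \<and> q \<in> V \<and> (\<exists>p W f. chart M \<alpha> p V W f \<and> emeasure haar W < \<infinity>)"
    if q: "q \<in> topspace M" for q
  proof -
    obtain V W f where "chart M \<alpha> q V W f" "emeasure haar W < \<infinity>"
      using chart_finite_exists[OF q] .
    moreover from this have "openin M V" "q \<in> V"
      unfolding chart_def by blast+
    ultimately show ?thesis by blast
  qed
  obtain V :: "nat \<Rightarrow> 'm set"
    where "\<And>n. openin M (V n)"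
      and V: "\<And>n. \<exists>p W f. chart M \<alpha> p (V n) W f \<and> emeasure haar W < \<infinity>"
        "topspace M \<subseteq> (\<Union>n. V n)"
  proof (rule second_countable_cover[OF second_countable False nhd])
    fix V :: "nat \<Rightarrow> 'm set"
    assume "\<And>n. openin M (V n)" "topspace M \<subseteq> (\<Union>n. V n)"
      "\<And>n. \<exists>p W f. chart M \<alpha> p (V n) W f \<and> emeasure haar W < \<infinity>"
    then show thesis by (intro that)
  qed
  have "\<forall>n. \<exists>p W f. chart M \<alpha> p (V n) W f \<and> emeasure haar W < \<infinity>"
    by (intro allI V)
  then obtain p W f where c: "\<forall>n. chart M \<alpha> (p n) (V n) (W n) (f n) \<and> emeasure haar (W n) < \<infinity>"
    unfolding choice_iff by (elim exE) (rule that)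
  show ?thesis
    using c V(2) by (intro canonical_exists_atlas[of p V W f]) simp_all
qed

lemma canonical_vol: "canonical_measure haar M \<alpha> (vol haar M \<alpha>)"
proof -
  have "\<exists>!\<nu>. canonical_measure haar M \<alpha> \<nu>"
    using canonical_exists canonical_unique by blast
  from theI'[OF this] show ?thesis
    unfolding vol_def canonical_measure_def .
qed

text \<open>Both sides are countably additive in A and D is the same near every point, so the
  computation in a pair of charts at p and p.g globalises.\<close>

lemma vol_translate:
  assumes D: "\<And>A. A \<in> sets borel \<Longrightarrow> emeasure haar ((\<lambda>x. x + g) ` A) = D * emeasure haar A"
    and A: "A \<in> borel_algebra M" "A \<subseteq> {x \<in> topspace M. (x, g) \<in> dom \<alpha>}"
  shows "emeasure (vol haar M \<alpha>) ((\<lambda>x. act \<alpha> x g) ` A) = D * emeasure (vol haar M \<alpha>) A"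
proof (rule countably_additive_eq_if_locally_eq[OF second_countable openin_translate_dom _ _ _ _ A])
  let ?S = "{x \<in> topspace M. (x, g) \<in> dom \<alpha>}"
  note borel = borel_algebra_image[OF openin_translate_dom inj_on_translate translate_open_map]
  show "countably_additive {K \<in> borel_algebra M. K \<subseteq> ?S}
      (\<lambda>K. emeasure (vol haar M \<alpha>) ((\<lambda>x. act \<alpha> x g) ` K))"
    by (rule countably_additive_image[OF inj_on_translate])
      (use borel in \<open>auto simp only: sets_canonical[OF canonical_vol] mem_Collect_eq\<close>)
  show "countably_additive {K \<in> borel_algebra M. K \<subseteq> ?S} (\<lambda>K. D * emeasure (vol haar M \<alpha>) K)"
    using canonical_countably_additive[OF canonical_vol, of ?S]
    unfolding countably_additive_def by (simp add: ennreal_suminf_cmult)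
  fix p assume p: "p \<in> ?S"
  then have pg: "(p, g) \<in> dom \<alpha>" by blast
  obtain V W f where c: "chart M \<alpha> p V W f"
    using chart_exists p by blast
  obtain V' W' f' where c': "chart M \<alpha> (act \<alpha> p g) V' W' f'"
    using chart_exists act_topspace[OF pg] by blast
  obtain U where U: "openin M U" "p \<in> U" "U \<subseteq> {x \<in> V. (x, g) \<in> dom \<alpha>}"
      "\<And>x. x \<in> U \<Longrightarrow> act \<alpha> x g \<in> V'" "\<And>x. x \<in> U \<Longrightarrow> f' (act \<alpha> x g) = - g + f x + g"
    by (rule translate_chart[OF c pg c']) blast
  have "emeasure (vol haar M \<alpha>) ((\<lambda>x. act \<alpha> x g) ` K) = D * emeasure (vol haar M \<alpha>) K"
    if K: "K \<in> borel_algebra M" "K \<subseteq> U" for K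
  proof -
    have KV: "K \<subseteq> V" using K(2) U(3) by blast
    have fK: "f ` K \<in> sets borel"
      using K(1) KV by (rule chart_borel_image[OF c])
    have "K \<subseteq> ?S" using K(2) U(3) openin_subset[OF U(1)] by blast
    then have "(\<lambda>x. act \<alpha> x g) ` K \<in> borel_algebra M"
      by (intro borel K(1)) 
    moreover have "(\<lambda>x. act \<alpha> x g) ` K \<subseteq> V'" using K(2) U(4) by blast
    ultimately have "emeasure (vol haar M \<alpha>) ((\<lambda>x. act \<alpha> x g) ` K)
        = emeasure haar (f' ` (\<lambda>x. act \<alpha> x g) ` K)"
      by (rule emeasure_canonical[OF canonical_vol c'])
    also have "f' ` (\<lambda>x. act \<alpha> x g) ` K = (\<lambda>y. - g + y) ` (\<lambda>y. y + g) ` f ` K"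
      unfolding image_image using K(2) U(5) by (intro image_cong) (auto simp: add.assoc)
    also have "emeasure haar \<dots> = emeasure haar ((\<lambda>y. y + g) ` f ` K)"
      by (rule left_invariant_emeasure[OF haar_left_invariant[OF haar] borel_right_translation[OF fK]])
    also have "\<dots> = D * emeasure haar (f ` K)"
      using fK by (rule D)
    also have "emeasure haar (f ` K) = emeasure (vol haar M \<alpha>) K"
      using emeasure_canonical[OF canonical_vol c K(1) KV] ..
    finally show ?thesis .
  qed
  then show "\<exists>U. openin M U \<and> p \<in> U \<and> (\<forall>K\<in>borel_algebra M. K \<subseteq> U \<longrightarrow>
      emeasure (vol haar M \<alpha>) ((\<lambda>x. act \<alpha> x g) ` K) = D * emeasure (vol haar M \<alpha>) K)"
    using U(1,2) by blast
qed simp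

text \<open>A chart range is open and nonempty, hence of positive Haar measure. This allows
  cancelling the total volume.\<close>

lemma vol_pos:
  assumes "topspace M \<noteq> {}"
  shows "emeasure (vol haar M \<alpha>) (topspace M) \<noteq> 0"
proof -
  obtain p where "p \<in> topspace M" using assms by blast
  then obtain V W f where c: "chart M \<alpha> p V W f" by (rule chart_exists)
  have "emeasure haar W \<noteq> 0"
    using chart_open_range[OF c] chart_zero[OF c] by (intro haar_open_pos[OF haar]) auto
  moreover have "emeasure (vol haar M \<alpha>) V = emeasure haar W"
    using emeasure_canonical[OF canonical_vol c, of V] chart_openin[OF c] chart_image[OF c]
    by (simp add: borel_algebra_openin)
  moreover have "emeasure (vol haar M \<alpha>) V \<le> emeasure (vol haar M \<alpha>) (topspace M)"
    using openin_subset[OF chart_openin[OF c]]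
    by (intro emeasure_mono) (auto simp: sets_canonical[OF canonical_vol] borel_algebra_openin)
  ultimately show ?thesis by auto
qed

end

section \<open>Soficity and the modulus of a single group element\<close>

text \<open>If \<open>M[U]\<close> were not measurable, its \<open>emeasure\<close> would be \<open>0\<close> and the estimate trivial, so
  measurability of \<open>M[U]\<close> need not be established.\<close>

lemma sofic_approx_modulus:
  fixes haar :: "'g::{topological_group_add, t2_space, second_countable_topology} measure"
    and M :: "'m topology"
  assumes lc: "locally_compact_space (euclidean :: 'g topology)" and haar: "left_haar_measure haar"
    and D: "\<And>A. A \<in> sets borel \<Longrightarrow> emeasure haar ((\<lambda>x. x + g) ` A) = D * emeasure haar A"
    and M: "sofic_approx haar U \<epsilon> M \<alpha>" "topspace M \<noteq> {}" and g: "g \<in> U"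
  shows "D * ennreal (1 - \<epsilon>) \<le> 1"
proof -
  interpret haar_local_G M \<alpha> haar
    using M lc haar by unfold_locales (simp_all only: sofic_approx_def)
  let ?vol = "vol haar M \<alpha>" and ?A = "good_points M \<alpha> U"
  define v where "v = emeasure ?vol (topspace M)"
  have v: "v \<noteq> 0" "v < \<infinity>" "ennreal (1 - \<epsilon>) * v \<le> emeasure ?vol ?A"
    using vol_pos[OF M(2)] M(1) by (auto simp: v_def sofic_approx_def)
  have "D * ennreal (1 - \<epsilon>) * v \<le> 1 * v"
  proof (cases "?A \<in> sets ?vol")
    case True
    \<comment> \<open>\<open>orbit_map_homeo\<close> at a point p of M[U] makes p.g defined for
      every g in U.\<close>
    have sub: "?A \<subseteq> {x \<in> topspace M. (x, g) \<in> dom \<alpha>}"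
      using g unfolding good_points_def orbit_map_homeo_def by blast
    have "D * ennreal (1 - \<epsilon>) * v \<le> D * emeasure ?vol ?A"
      using v(3) by (simp add: mult.assoc mult_left_mono)
    also have "\<dots> = emeasure ?vol ((\<lambda>x. act \<alpha> x g) ` ?A)"
      using True sub by (intro vol_translate[symmetric, OF D]) (simp_all only: sets_canonical[OF canonical_vol])
    also have "\<dots> \<le> v"
      unfolding v_def using sub act_topspace
      by (intro emeasure_mono) (auto simp: sets_canonical[OF canonical_vol] borel_algebra_openin)
    finally show ?thesis by simp
  next
    case False
    then have "ennreal (1 - \<epsilon>) * v = 0"
      using v(3) by (simp add: emeasure_notin_sets)
    then show ?thesis by (simp only: mult.assoc mult_zero_right zero_le)
  qed
  \<comment> \<open>Cancelling v in \<open>ennreal\<close> uses 0 < v < \<infinity>, that is,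
    \<open>vol_pos\<close> and the finite volume of M.\<close>
  then have "v * (D * ennreal (1 - \<epsilon>)) \<le> v * 1"
    by (simp only: mult_ac)
  then show ?thesis
    by (subst (asm) ennreal_mult_le_mult_iff) (use v in auto)
qed

theorem theorem3p2:
  fixes haar :: "'g::{topological_group_add, t2_space, second_countable_topology} measure"
  assumes "locally_compact_space (euclidean :: 'g topology)"
    and "left_haar_measure haar"
    and "sofic TYPE('m) haar"
  shows "unimodular haar"
proof -
  obtain M :: "nat \<Rightarrow> 'm topology" and \<alpha> U \<epsilon> where s: "\<And>i. sofic_approx haar (U i) (\<epsilon> i) (M i) (\<alpha> i)"
      "incseq U" "(\<Union>i. U i) = UNIV" "\<epsilon> \<longlonglongrightarrow> 0" "\<forall>\<^sub>F i in sequentially. topspace (M i) \<noteq> {}"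
    using assms(3) unfolding sofic_def by blast
  have le: "emeasure haar ((\<lambda>x. x + g) ` A) \<le> emeasure haar A" if A: "A \<in> sets borel" for g A
  proof -
    obtain D where Dfin: "D \<noteq> \<infinity>"
      and D: "\<And>A. A \<in> sets borel \<Longrightarrow> emeasure haar ((\<lambda>x. x + g) ` A) = D * emeasure haar A"
      using haar_right_translation[OF assms(1,2), of g] by blast
    obtain n where "g \<in> U n" using s(3) by blast
    then have "g \<in> U i" if "i \<ge> n" for i
      using s(2) that by (auto simp: incseq_def)
    then have "\<forall>\<^sub>F i in sequentially. g \<in> U i"
      by (auto simp: eventually_sequentially)
    with s(5) have "\<forall>\<^sub>F i in sequentially. D * ennreal (1 - \<epsilon> i) \<le> 1"
      by eventually_elim (rule sofic_approx_modulus[OF assms(1,2) D s(1)])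
    \<comment> \<open>Finiteness of D makes multiplication by D continuous on
      \<open>ennreal\<close>.\<close>
    moreover have "(\<lambda>i. D * ennreal (1 - \<epsilon> i)) \<longlonglongrightarrow> D * ennreal (1 - 0)"
      using s(4) Dfin by (intro ennreal_tendsto_cmult tendsto_intros) (auto simp: less_top)
    ultimately have "D * ennreal (1 - 0) \<le> 1"
      by (intro tendsto_upperbound) auto
    then show ?thesis
      using D[OF A] mult_right_mono[of D 1 "emeasure haar A"] by simp
  qed
  have "emeasure haar ((\<lambda>x. x + g) ` A) = emeasure haar A" if A: "A \<in> sets borel" for g A
  proof (rule antisym[OF le[OF A]])
    \<comment> \<open>Instead of relating the constants of g and - g, the bound for - g is applied
      to the set A + g.\<close>
    have "emeasure haar A = emeasure haar ((\<lambda>x. x + (- g)) ` (\<lambda>x. x + g) ` A)"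
      by (simp add: image_image)
    also have "\<dots> \<le> emeasure haar ((\<lambda>x. x + g) ` A)"
      by (rule le[OF borel_right_translation[OF A]])
    finally show "emeasure haar A \<le> emeasure haar ((\<lambda>x. x + g) ` A)" .
  qed
  then show ?thesis
    using left_invariant_sets[OF haar_left_invariant[OF assms(2)]] by (simp add: unimodular_def)
qed

end
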